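(* The map sending a function $\mathbb{V}(m)$ to the function $\mathbb{V}(m)-m^2$ is a bijection of $\mathcal{V}_\infty$ onto $\mathcal{V}$.
   Context: Let $\nu$ be a non-degenerate compactly supported probability measure on $\mathbb{R}$ with $\int x\,\nu(dx)=0$. The variance function $\mathbb{V}_\nu$ of the Cauchy-Stieltjes Kernel (CSK) family generated by $\nu$ is the unique function $\mathbb{V}$, real analytic in a neighbourhood of $0$ with $\mathbb{V}(0)\neq 0$, such that for all $m$ in some open interval $(m_-,m_+)$ containing $0$ the formula $$Q_m(dx)=f(x,m)\,\nu(dx),\qquad f(x,m)=\frac{\mathbb{V}(m)}{\mathbb{V}(m)+m(m-x)}\ (m\ne 0),\quad f(x,0)=1,$$ defines a probability measure. (Existence and uniqueness are known; one then has $\int x\,Q_m(dx)=m$ and $\mathbb{V}(m)=\int (x-m)^2 Q_m(dx)$, so $\mathbb{V}_\nu(0)=\int x^2\nu(dx)$.) Variance functions are regarded as germs at $0$: two functions that agree near $0$ are identified. $\mathcal{V}$ denotes the class of variance functions $\mathbb{V}_\nu$ where $\nu$ is a compactly supported probability measure on $\mathbb{R}$ with $\int x\,\nu(dx)=0$ and $\int x^2\nu(dx)=1$ (so $\mathbb{V}_\nu(0)=1$). $\mathcal{V}_\infty$ denotes the class of those $\mathbb{V}\in\mathcal{V}$ such that the function $m\mapsto \mathbb{V}(cm)$ is in $\mathcal{V}$ for every real $c$. *)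

theory Defs
  imports "HOL-Probability.Probability"
begin

definition real_analytic_on :: "(real \<Rightarrow> real) \<Rightarrow> real set \<Rightarrow> bool"
    (infixl \<open>real'_analytic'_on\<close> 50) where
  "f real_analytic_on S \<longleftrightarrow> (\<forall>x\<in>S. \<exists>F. (\<lambda>h. f (x + h)) has_fps_expansion F)"

definition compactly_supported :: "real measure \<Rightarrow> bool" where
  "compactly_supported \<nu> \<longleftrightarrow> (\<exists>K. compact K \<and> (AE x in \<nu>. x \<in> K))"

definition csk_denom :: "(real \<Rightarrow> real) \<Rightarrow> real \<Rightarrow> real \<Rightarrow> real" where
  "csk_denom V m x = V m + m * (m - x)"

definition csk_density :: "(real \<Rightarrow> real) \<Rightarrow> real \<Rightarrow> real \<Rightarrow> real" where
  "csk_density V m x = (if m = 0 then 1 else V m / csk_denom V m x)"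

text \<open>
  For \<open>csk_density V m\<close> to define a probability measure, the quotient has to make sense and
  be nonnegative \<open>\<nu>\<close>-almost everywhere. Both are stated explicitly, since division by zero
  yields zero and \<^const>\<open>ennreal\<close> truncates negative values to zero.
\<close>

definition csk_probability :: "real measure \<Rightarrow> (real \<Rightarrow> real) \<Rightarrow> real \<Rightarrow> bool" where
  "csk_probability \<nu> V m \<longleftrightarrow>
     (m \<noteq> 0 \<longrightarrow> (AE x in \<nu>. csk_denom V m x \<noteq> 0)) \<and>
     (AE x in \<nu>. 0 \<le> csk_density V m x) \<and>
     prob_space (density \<nu> (\<lambda>x. ennreal (csk_density V m x)))"

text \<open>
  A relation rather than a function of \<open>\<nu>\<close>: for nondegenerate, centred, compactly supported
  \<open>\<nu>\<close> such a \<open>V\<close> exists, and its germ at \<open>0\<close> is unique.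
\<close>

definition is_variance_function :: "real measure \<Rightarrow> (real \<Rightarrow> real) \<Rightarrow> bool" where
  "is_variance_function \<nu> V \<longleftrightarrow>
     (\<exists>U. open U \<and> 0 \<in> U \<and> V real_analytic_on U) \<and> V 0 \<noteq> 0 \<and>
     (\<exists>a b. a < 0 \<and> 0 < b \<and> (\<forall>m\<in>{a<..<b}. csk_probability \<nu> V m))"

quotient_type real_germ = "real \<Rightarrow> real" / "\<lambda>f g. \<forall>\<^sub>F m in nhds 0. f m = g m"
  morphisms rep_germ germ
proof (rule equivpI)
  show "reflp (\<lambda>f g :: real \<Rightarrow> real. \<forall>\<^sub>F m in nhds 0. f m = g m)"
    by (simp add: reflp_def)
  show "symp (\<lambda>f g :: real \<Rightarrow> real. \<forall>\<^sub>F m in nhds 0. f m = g m)"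
    by (simp add: symp_def eq_commute)
  show "transp (\<lambda>f g :: real \<Rightarrow> real. \<forall>\<^sub>F m in nhds 0. f m = g m)"
    by (rule transpI) (auto elim: eventually_elim2)
qed

lift_definition germ_dilate :: "real \<Rightarrow> real_germ \<Rightarrow> real_germ" is "\<lambda>c V m. V (c * m)"
proof -
  fix c :: real and V W :: "real \<Rightarrow> real"
  assume "\<forall>\<^sub>F m in nhds 0. V m = W m"
  moreover have "filterlim (\<lambda>m. c * m) (nhds 0) (nhds 0)"
    using tendsto_mult[OF tendsto_const[of c] tendsto_ident_at[of 0 UNIV]]
    by (simp add: tendsto_nhds_iff)
  ultimately show "\<forall>\<^sub>F m in nhds 0. V (c * m) = W (c * m)"
    by (rule eventually_compose_filterlim)
qed

lift_definition germ_minus_square :: "real_germ \<Rightarrow> real_germ" is "\<lambda>V m. V m - m\<^sup>2"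
  by (auto elim: eventually_mono)

definition variance_germs :: "real_germ set" (\<open>\<V>\<close>) where
  "\<V> = {germ V | V \<nu>. real_distribution \<nu> \<and> compactly_supported \<nu> \<and>
          (LINT x|\<nu>. x) = 0 \<and> (LINT x|\<nu>. x\<^sup>2) = 1 \<and> is_variance_function \<nu> V}"

definition variance_germs_inf :: "real_germ set" (\<open>\<V>\<^sub>\<infinity>\<close>) where
  "\<V>\<^sub>\<infinity> = {v \<in> \<V>. \<forall>c. germ_dilate c v \<in> \<V>}"

end

theory Submission
  imports Defs
begin

text \<open>
  Write \<open>C = V + m\<^sup>2\<close>. Substituting \<open>w = m / C(m)\<close>, the condition that the kernel density integrates to \<open>1\<close> becomes
  \<open>\<integral> 1 / (1 - w x) \<nu>(dx) = C(m) / V(m)\<close>. The left side is the moment generating series of \<open>\<nu>\<close> at \<open>w\<close>.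
  Since \<open>\<nu>\<close> has mean \<open>0\<close> and variance \<open>1\<close>, this series has the form \<open>1 / (1 - w\<^sup>2 N(w))\<close>, where \<open>N\<close> is the moment
  series of another compactly supported probability measure \<open>\<mu>\<close> (one step of the continued fraction of the
  Cauchy transform), and the condition turns into \<open>N(m / C(m)) = C(m)\<close>, equivalently \<open>N(w) = C(w N(w))\<close>. This is
  the relation between the moment series of \<open>\<mu>\<close> and its free cumulant series. So a germ \<open>V\<close> with \<open>V(0) = 1\<close> belongs to
  \<open>\<V>\<close> if and only if \<open>V + m\<^sup>2\<close> is the free cumulant series of a compactly supported probability measure
  (\<open>variance_function_imp_hankel_psd\<close> and \<open>hankel_psd_imp_variance_function\<close>).

  Rescaling \<open>m\<close> dilates \<open>\<mu>\<close>. Hence \<open>V\<close> belongs to \<open>\<V>\<^sub>\<infinity>\<close> if and only if \<open>V + t m\<^sup>2\<close> is a free cumulant series of a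
  probability measure for every \<open>t > 0\<close>; the dilation with \<open>c = 0\<close> gives the constant germ \<open>1\<close>, which is the variance
  function of the semicircle law. Letting \<open>t\<close> tend to \<open>0\<close>, \<open>V\<close> itself is such a series. Conversely, if \<open>V\<close> is one, then so is \<open>V + t m\<^sup>2\<close>,
  because adding \<open>t m\<^sup>2\<close> to the cumulants is free convolution with a semicircle law. Thus \<open>V \<in> \<V>\<^sub>\<infinity>\<close> if and only if
  \<open>(V - m\<^sup>2) + m\<^sup>2\<close> is a free cumulant series, that is, if and only if \<open>V - m\<^sup>2 \<in> \<V>\<close>.

  Measures enter only through their moments: a power series with positive radius of convergence and constant term
  \<open>1\<close> is a moment series of a compactly supported probability measure if and only if its coefficients form a positive
  semidefinite Hankel matrix (\<open>hamburger_moment_problem_bounded\<close>). In these terms the limit \<open>t \<rightarrow> 0\<close> is immediate,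
  because positivity is a closed condition on coefficients and each coefficient depends continuously on \<open>t\<close>. The
  continued fraction step is a congruence of quadratic forms (\<open>hankel_psd_jacobi\<close>, \<open>hankel_psd_strip\<close>), and the
  convolution with the semicircle law is obtained by iterating a map on moment series that preserves positivity
  (\<open>hankel_psd_moment_series_add_square\<close>).
\<close>

unbundle fps_syntax
unbundle no vec_syntax

section \<open>Positive definite Hankel forms\<close>

definition hankel_psd :: "(nat \<Rightarrow> real) \<Rightarrow> bool" where
  "hankel_psd s \<longleftrightarrow> (\<forall>n c. 0 \<le> (\<Sum>i<n. \<Sum>j<n. c i * c j * s (i + j)))"

text \<open>
  Both directions of the continued fraction step have this shape: up to a rank-one square, the Hankel form of \<open>t\<close>
  is the Hankel form of \<open>s\<close> in transformed coefficients.
\<close>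

lemma hankel_psdI_congruence:
  assumes s: "hankel_psd s"
    and t: "\<And>n. \<exists>m (u :: nat \<Rightarrow> real) A. \<forall>k<n. \<forall>l<n. t (k + l) = u k * u l + (\<Sum>i<m. \<Sum>j<m. A k i * A l j * s (i + j))"
  shows "hankel_psd t"
  unfolding hankel_psd_def
proof (intro allI)
  fix n and c :: "nat \<Rightarrow> real"
  obtain m and u :: "nat \<Rightarrow> real" and A where tA: "\<And>k l. k < n \<Longrightarrow> l < n \<Longrightarrow>
    t (k + l) = u k * u l + (\<Sum>i<m. \<Sum>j<m. A k i * A l j * s (i + j))"
    using t[of n] by blast
  define d where "d i = (\<Sum>k<n. c k * A k i)" for i
  have "(\<Sum>k<n. \<Sum>l<n. c k * c l * t (k + l)) =
      (\<Sum>k<n. \<Sum>l<n. c k * c l * (u k * u l)) +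
      (\<Sum>k<n. \<Sum>l<n. \<Sum>i<m. \<Sum>j<m. (c k * A k i) * (c l * A l j) * s (i + j))"
    by (simp add: tA algebra_simps sum.distrib sum_distrib_left)
  also have "(\<Sum>k<n. \<Sum>l<n. c k * c l * (u k * u l)) = (\<Sum>k<n. c k * u k)\<^sup>2"
    by (simp add: power2_eq_square sum_product mult_ac)
  also have "(\<Sum>k<n. \<Sum>l<n. \<Sum>i<m. \<Sum>j<m. (c k * A k i) * (c l * A l j) * s (i + j)) =
      (\<Sum>i<m. \<Sum>k<n. \<Sum>l<n. \<Sum>j<m. (c k * A k i) * (c l * A l j) * s (i + j))"
  proof -
    have "(\<Sum>k<n. \<Sum>l<n. \<Sum>i<m. \<Sum>j<m. (c k * A k i) * (c l * A l j) * s (i + j)) =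
        (\<Sum>k<n. \<Sum>i<m. \<Sum>l<n. \<Sum>j<m. (c k * A k i) * (c l * A l j) * s (i + j))"
      by (rule sum.cong[OF refl], rule sum.swap)
    also have "\<dots> = (\<Sum>i<m. \<Sum>k<n. \<Sum>l<n. \<Sum>j<m. (c k * A k i) * (c l * A l j) * s (i + j))"
      by (rule sum.swap)
    finally show ?thesis .
  qed
  also have "\<dots> = (\<Sum>i<m. \<Sum>j<m. d i * d j * s (i + j))"
  proof (rule sum.cong[OF refl])
    fix i
    have "(\<Sum>k<n. \<Sum>l<n. \<Sum>j<m. (c k * A k i) * (c l * A l j) * s (i + j)) =
        (\<Sum>k<n. \<Sum>j<m. \<Sum>l<n. (c k * A k i) * (c l * A l j) * s (i + j))"
      by (rule sum.cong[OF refl], rule sum.swap)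
    also have "\<dots> = (\<Sum>j<m. \<Sum>k<n. \<Sum>l<n. (c k * A k i) * (c l * A l j) * s (i + j))"
      by (rule sum.swap)
    also have "\<dots> = (\<Sum>j<m. d i * d j * s (i + j))"
      unfolding d_def sum_product
      unfolding sum_distrib_right ..
    finally show "(\<Sum>k<n. \<Sum>l<n. \<Sum>j<m. (c k * A k i) * (c l * A l j) * s (i + j)) =
        (\<Sum>j<m. d i * d j * s (i + j))" .
  qed
  finally show "0 \<le> (\<Sum>k<n. \<Sum>l<n. c k * c l * t (k + l))"
    using s by (simp add: hankel_psd_def)
qed

lemma hankel_psd_scale:
  assumes "hankel_psd s"
  shows "hankel_psd (\<lambda>n. c ^ n * s n)"
  unfolding hankel_psd_def
proof (intro allI)
  fix n d
  have "(\<Sum>i<n. \<Sum>j<n. d i * d j * (c ^ (i + j) * s (i + j))) =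
        (\<Sum>i<n. \<Sum>j<n. (d i * c ^ i) * (d j * c ^ j) * s (i + j))"
    by (simp add: power_add mult_ac)
  then show "0 \<le> (\<Sum>i<n. \<Sum>j<n. d i * d j * (c ^ (i + j) * s (i + j)))"
    using assms unfolding hankel_psd_def by simp
qed

lemma hankel_psd_limit:
  assumes psd: "eventually (\<lambda>t. hankel_psd (s t)) F" and F: "F \<noteq> bot"
    and lim: "\<And>n. ((\<lambda>t. s t n) \<longlongrightarrow> l n) F"
  shows "hankel_psd l"
  unfolding hankel_psd_def
proof (intro allI)
  fix n c
  have "((\<lambda>t. \<Sum>i<n. \<Sum>j<n. c i * c j * s t (i + j)) \<longlongrightarrow> (\<Sum>i<n. \<Sum>j<n. c i * c j * l (i + j))) F"
    by (intro tendsto_intros lim)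
  moreover have "eventually (\<lambda>t. 0 \<le> (\<Sum>i<n. \<Sum>j<n. c i * c j * s t (i + j))) F"
    using psd by eventually_elim (simp add: hankel_psd_def)
  ultimately show "0 \<le> (\<Sum>i<n. \<Sum>j<n. c i * c j * l (i + j))"
    using F by (rule tendsto_lowerbound)
qed

section \<open>One step of the Jacobi continued fraction\<close>

text \<open>
  The relation \<open>P (1 - a w - w\<^sup>2 N) = 1\<close> says that the measure with moment series \<open>P\<close> is the spectral measure, at the
  vacuum, of multiplication by the variable on \<open>L\<^sup>2\<close> of the measure with moment series \<open>N\<close>, coupled to a one-dimensional
  space with diagonal entry \<open>a\<close> and coupling \<open>1\<close>.
\<close>

lemma jacobi_recurrence:
  fixes P N :: "real fps"
  assumes "P * (1 - fps_const a * fps_X - fps_X\<^sup>2 * N) = 1"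
  shows "P $ 0 = 1"
    and "P $ Suc n = a * P $ n + (\<Sum>l<n. P $ (n - Suc l) * N $ l)"
proof -
  have P: "P = 1 + fps_X * (fps_const a * P) + fps_X * (fps_X * (N * P))"
    using assms by (simp add: algebra_simps power2_eq_square)
  show "P $ 0 = 1"
    using arg_cong[OF P, of "\<lambda>F. F $ 0"] by simp
  have "P $ Suc n = a * P $ n + (fps_X * (N * P)) $ n"
    using arg_cong[OF P, of "\<lambda>F. F $ Suc n"] by (simp del: fps_X_mult_nth add: fps_X_mult_nth[of _ "Suc n"])
  also have "(fps_X * (N * P)) $ n = (\<Sum>l<n. P $ (n - Suc l) * N $ l)"
    by (cases n) (simp_all add: fps_mult_nth[of N] lessThan_Suc_atMost atLeast0AtMost mult.commute)
  finally show "P $ Suc n = a * P $ n + (\<Sum>l<n. P $ (n - Suc l) * N $ l)" .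
qed

text \<open>
  The right side is the inner product of the \<open>i\<close>-th and \<open>j\<close>-th iterates of the vacuum under the coupled operator: the
  vacuum components are \<open>P $ i\<close> and \<open>P $ j\<close>, the remaining components are the polynomials with coefficients
  \<open>P $ (i - 1 - k)\<close>. Symmetry of the operator makes it depend only on \<open>i + j\<close>, and that is the induction step.
\<close>

lemma jacobi_hankel:
  fixes P N :: "real fps"
  assumes "P * (1 - fps_const a * fps_X - fps_X\<^sup>2 * N) = 1"
  shows "P $ (i + j) = P $ i * P $ j +
    (\<Sum>k<i. \<Sum>l<j. P $ (i - Suc k) * P $ (j - Suc l) * N $ (k + l))"
proof (induction i arbitrary: j)
  case 0
  then show ?case
    using jacobi_recurrence[OF assms] by simp
next
  case (Suc i)
  note rec = jacobi_recurrence[OF assms]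
  define T where "T = (\<Sum>k<i. \<Sum>l<j. P $ (i - Suc k) * P $ (j - Suc l) * N $ Suc (k + l))"
  have 1: "(\<Sum>k<i. \<Sum>l<Suc j. P $ (i - Suc k) * P $ (Suc j - Suc l) * N $ (k + l)) =
      P $ j * (\<Sum>k<i. P $ (i - Suc k) * N $ k) + T"
    unfolding T_def
    by (simp add: sum.lessThan_Suc_shift sum.distrib sum_distrib_left mult_ac del: sum.lessThan_Suc)
  have 2: "(\<Sum>k<Suc i. \<Sum>l<j. P $ (Suc i - Suc k) * P $ (j - Suc l) * N $ (k + l)) =
      P $ i * (\<Sum>l<j. P $ (j - Suc l) * N $ l) + T"
    unfolding T_def
    by (simp add: sum.lessThan_Suc_shift sum.distrib sum_distrib_left mult_ac del: sum.lessThan_Suc)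
  have "P $ (Suc i + j) = P $ (i + Suc j)"
    by simp
  also have "\<dots> = P $ i * P $ Suc j + (P $ j * (\<Sum>k<i. P $ (i - Suc k) * N $ k) + T)"
    unfolding Suc.IH[of "Suc j"] 1 ..
  also have "\<dots> = P $ Suc i * P $ j + (P $ i * (\<Sum>l<j. P $ (j - Suc l) * N $ l) + T)"
    unfolding rec(2)[of i] rec(2)[of j] by (simp add: algebra_simps)
  finally show ?case
    unfolding 2 .
qed

text \<open>
  The same identity with summation ranges that do not depend on \<open>i\<close> and \<open>j\<close>, so that it can serve as a congruence.
\<close>

lemma jacobi_hankel':
  fixes P N :: "real fps"
  assumes "P * (1 - fps_const a * fps_X - fps_X\<^sup>2 * N) = 1" and "i \<le> m" "j \<le> m"
  shows "P $ (i + j) = P $ i * P $ j +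
    (\<Sum>k<m. \<Sum>l<m. (fps_X ^ Suc k * P) $ i * (fps_X ^ Suc l * P) $ j * N $ (k + l))"
proof -
  have "(\<Sum>k<i. \<Sum>l<j. P $ (i - Suc k) * P $ (j - Suc l) * N $ (k + l)) =
     (\<Sum>k<i. \<Sum>l<j. (fps_X ^ Suc k * P) $ i * (fps_X ^ Suc l * P) $ j * N $ (k + l))"
    by (intro sum.cong refl) (simp add: fps_X_power_mult_nth del: power_Suc)
  also have "\<dots> = (\<Sum>k<i. \<Sum>l<m. (fps_X ^ Suc k * P) $ i * (fps_X ^ Suc l * P) $ j * N $ (k + l))"
    by (intro sum.cong refl sum.mono_neutral_left)
       (use assms(3) in \<open>auto simp: fps_X_power_mult_nth simp del: power_Suc\<close>)
  also have "\<dots> = (\<Sum>k<m. \<Sum>l<m. (fps_X ^ Suc k * P) $ i * (fps_X ^ Suc l * P) $ j * N $ (k + l))"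
    by (intro sum.mono_neutral_left)
       (use assms(2) in \<open>auto simp: fps_X_power_mult_nth simp del: power_Suc\<close>)
  finally show ?thesis
    using jacobi_hankel[OF assms(1), of i j] by simp
qed

lemma hankel_psd_jacobi:
  fixes P N :: "real fps"
  assumes "P * (1 - fps_const a * fps_X - fps_X\<^sup>2 * N) = 1" and "hankel_psd (fps_nth N)"
  shows "hankel_psd (fps_nth P)"
proof (rule hankel_psdI_congruence[OF assms(2)])
  fix n
  show "\<exists>m u A. \<forall>k<n. \<forall>l<n. P $ (k + l) = u k * u l + (\<Sum>i<m. \<Sum>j<m. A k i * A l j * N $ (i + j))"
    by (intro exI[of _ n] exI[of _ "fps_nth P"] exI[of _ "\<lambda>k i. (fps_X ^ Suc i * P) $ k"] allI impI
        jacobi_hankel'[OF assms(1)]) simp_all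
qed

text \<open>
  The vectors in the decomposition of \<open>jacobi_hankel\<close> form a triangular system with unit
  diagonal. Its inverse is given by the coefficients of \<open>\<gamma> = 1 / P\<close>; the combinations that it produces are orthogonal to
  the vacuum, so the rank-one term drops out and the form of \<open>N\<close> is a congruent copy of that of \<open>P\<close>.
\<close>

lemma hankel_psd_strip:
  fixes P N :: "real fps"
  assumes eq: "P * (1 - fps_const a * fps_X - fps_X\<^sup>2 * N) = 1" and P: "hankel_psd (fps_nth P)"
  shows "hankel_psd (fps_nth N)"
proof (rule hankel_psdI_congruence[OF P])
  fix n
  define \<gamma> where "\<gamma> = 1 - fps_const a * fps_X - fps_X\<^sup>2 * N"
  define A where "A k i = (if i \<le> Suc k then \<gamma> $ (Suc k - i) else 0)" for k i
  have conv: "(\<Sum>i<Suc n. A k i * B $ i) = (\<gamma> * B) $ Suc k" if "k < n" for k and B :: "real fps"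
  proof -
    have "(\<gamma> * B) $ Suc k = (\<Sum>i\<le>Suc k. A k i * B $ i)"
      unfolding mult.commute[of \<gamma>] fps_mult_nth atLeast0AtMost
      by (rule sum.cong) (simp_all add: A_def)
    also have "\<dots> = (\<Sum>i<Suc n. A k i * B $ i)"
      by (rule sum.mono_neutral_left) (use that in \<open>auto simp: A_def\<close>)
    finally show ?thesis ..
  qed
  have \<gamma>P: "\<gamma> * P = 1"
    using eq unfolding \<gamma>_def by (subst mult.commute)
  \<comment> \<open>orthogonality to the vacuum, and inversion of the triangular system\<close>
  have A0: "(\<Sum>i<Suc n. A k i * P $ i) = 0" if "k < n" for k
    using conv[OF that, of P] by (simp add: \<gamma>P)
  have A1: "(\<Sum>i<Suc n. A k i * (fps_X ^ Suc p * P) $ i) = (if p = k then 1 else 0)" if "k < n" for k p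
  proof -
    have "\<gamma> * (fps_X ^ Suc p * P) = fps_X ^ Suc p"
      by (simp only: mult.left_commute[of \<gamma>] \<gamma>P mult_1_right)
    then show ?thesis
      by (simp only: conv[OF that]) (simp add: fps_X_power_iff del: power_Suc)
  qed
  have "N $ (k + l) = 0 * 0 + (\<Sum>i<Suc n. \<Sum>j<Suc n. A k i * A l j * P $ (i + j))"
    if kl: "k < n" "l < n" for k l
  proof -
    let ?\<beta> = "\<lambda>i p. (fps_X ^ Suc p * P) $ i"
    have row: "(\<Sum>i<Suc n. A k i * P $ (i + j)) = (\<Sum>q<n. ?\<beta> j q * N $ (k + q))" if "j < Suc n" for j
    proof -
      have "(\<Sum>i<Suc n. A k i * P $ (i + j)) =
         (\<Sum>i<Suc n. A k i * P $ i * P $ j + (\<Sum>p<n. \<Sum>q<n. A k i * ?\<beta> i p * ?\<beta> j q * N $ (p + q)))"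
      proof (intro sum.cong refl)
        fix i assume "i \<in> {..<Suc n}"
        with that have "i \<le> n" "j \<le> n"
          by auto
        from jacobi_hankel'[OF eq this]
        show "A k i * P $ (i + j) = A k i * P $ i * P $ j +
            (\<Sum>p<n. \<Sum>q<n. A k i * ?\<beta> i p * ?\<beta> j q * N $ (p + q))"
          by (simp only: distrib_left sum_distrib_left mult.assoc)
      qed
      also have "\<dots> = (\<Sum>i<Suc n. A k i * P $ i) * P $ j +
          (\<Sum>i<Suc n. \<Sum>p<n. \<Sum>q<n. A k i * ?\<beta> i p * ?\<beta> j q * N $ (p + q))"
        by (simp only: sum.distrib sum_distrib_right)
      also have "(\<Sum>i<Suc n. \<Sum>p<n. \<Sum>q<n. A k i * ?\<beta> i p * ?\<beta> j q * N $ (p + q)) =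
          (\<Sum>p<n. \<Sum>i<Suc n. \<Sum>q<n. A k i * ?\<beta> i p * ?\<beta> j q * N $ (p + q))"
        by (rule sum.swap)
      also have "\<dots> = (\<Sum>p<n. \<Sum>q<n. \<Sum>i<Suc n. A k i * ?\<beta> i p * ?\<beta> j q * N $ (p + q))"
        by (intro sum.cong refl sum.swap)
      also have "\<dots> = (\<Sum>p<n. \<Sum>q<n. (\<Sum>i<Suc n. A k i * ?\<beta> i p) * (?\<beta> j q * N $ (p + q)))"
        by (simp only: sum_distrib_right mult.assoc)
      also have "\<dots> = (\<Sum>p<n. if p = k then \<Sum>q<n. ?\<beta> j q * N $ (p + q) else 0)"
        by (simp only: A1[OF kl(1)]) (rule sum.cong, simp_all)
      also have "\<dots> = (\<Sum>q<n. ?\<beta> j q * N $ (k + q))"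
        using kl(1) by simp
      finally show ?thesis
        by (simp only: A0[OF kl(1)] mult_zero_left add_0_left)
    qed
    have "(\<Sum>i<Suc n. \<Sum>j<Suc n. A k i * A l j * P $ (i + j)) =
        (\<Sum>j<Suc n. A l j * (\<Sum>i<Suc n. A k i * P $ (i + j)))"
      by (subst sum.swap) (simp only: sum_distrib_left mult.assoc mult.left_commute)
    also have "\<dots> = (\<Sum>j<Suc n. A l j * (\<Sum>q<n. ?\<beta> j q * N $ (k + q)))"
      by (intro sum.cong refl) (simp only: row lessThan_iff)
    also have "\<dots> = (\<Sum>q<n. (\<Sum>j<Suc n. A l j * ?\<beta> j q) * N $ (k + q))"
      by (simp only: sum_distrib_left sum_distrib_right mult.assoc) (rule sum.swap)
    also have "\<dots> = (\<Sum>q<n. if q = l then N $ (k + q) else 0)"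
      by (intro sum.cong refl) (simp only: A1[OF kl(2)] split: if_split, simp)
    also have "\<dots> = N $ (k + l)"
      using kl(2) by simp
    finally show ?thesis
      by simp
  qed
  then show "\<exists>m u B. \<forall>k<n. \<forall>l<n. N $ (k + l) = u k * u l + (\<Sum>i<m. \<Sum>j<m. B k i * B l j * P $ (i + j))"
    by (intro exI[of _ "Suc n"] exI[of _ "\<lambda>_. 0"] exI[of _ A] allI impI)
qed

section \<open>From free cumulants to moments\<close>

lemma fps_power_nth_tendsto:
  fixes A :: "'a \<Rightarrow> real fps"
  assumes "\<And>j. j \<le> k \<Longrightarrow> ((\<lambda>t. A t $ j) \<longlongrightarrow> B $ j) F"
  shows "((\<lambda>t. (A t ^ i) $ k) \<longlongrightarrow> (B ^ i) $ k) F"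
  using assms
proof (induction i arbitrary: k)
  case (Suc i)
  show ?case
    unfolding power_Suc fps_mult_nth
    by (intro tendsto_sum tendsto_mult Suc.IH Suc.prems) auto
qed simp

lemma fps_compose_nth_tendsto:
  fixes A C :: "'a \<Rightarrow> real fps"
  assumes "\<And>j. j \<le> k \<Longrightarrow> ((\<lambda>t. C t $ j) \<longlongrightarrow> D $ j) F"
    and "\<And>j. j \<le> k \<Longrightarrow> ((\<lambda>t. A t $ j) \<longlongrightarrow> B $ j) F"
  shows "((\<lambda>t. (C t oo A t) $ k) \<longlongrightarrow> (D oo B) $ k) F"
  unfolding fps_compose_nth
  by (intro tendsto_sum tendsto_mult fps_power_nth_tendsto assms) auto

text \<open>
  In the equation \<open>M = C \<circ> (w M)\<close> the \<open>n\<close>-th coefficient of the right side involves only coefficients of \<open>M\<close> below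
  \<open>n\<close>. Hence the solution depends continuously on \<open>C\<close>, coefficient by coefficient, and it is unique.
\<close>

lemma moment_fixpoint_tendsto:
  fixes M C :: "'a \<Rightarrow> real fps"
  assumes C: "\<And>n. ((\<lambda>t. C t $ n) \<longlongrightarrow> D $ n) F"
    and M: "eventually (\<lambda>t. M t = C t oo (fps_X * M t)) F" and L: "L = D oo (fps_X * L)"
  shows "((\<lambda>t. M t $ n) \<longlongrightarrow> L $ n) F"
proof (induction n rule: less_induct)
  case (less n)
  have "((\<lambda>t. (C t oo (fps_X * M t)) $ n) \<longlongrightarrow> (D oo (fps_X * L)) $ n) F"
  proof (intro fps_compose_nth_tendsto C)
    fix j assume "j \<le> n"
    then show "((\<lambda>t. (fps_X * M t) $ j) \<longlongrightarrow> (fps_X * L) $ j) F"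
      by (cases j) (auto intro!: less.IH)
  qed
  then show ?case
    unfolding L[symmetric]
    by (rule Lim_transform_eventually) (use M in \<open>eventually_elim, metis\<close>)
qed

lemma moment_fixpoint_unique:
  fixes M L C :: "real fps"
  assumes "M = C oo (fps_X * M)" "L = C oo (fps_X * L)"
  shows "M = L"
proof (rule fps_ext)
  fix n
  have "((\<lambda>_::nat. M $ n) \<longlongrightarrow> L $ n) sequentially"
    by (rule moment_fixpoint_tendsto[where C = "\<lambda>_. C" and D = C, OF tendsto_const always_eventually[OF allI]])
       (fact assms)+
  then show "M $ n = L $ n"
    by (simp add: tendsto_const_iff)
qed

text \<open>
  The moment series of the measure whose free cumulant series (with constant term \<open>1\<close>) is \<open>C\<close>. The
  inner function is the compositional inverse of \<open>m / C(m)\<close>; in the variable \<open>z = 1 / w\<close> this is Voiculescu's relation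
  between the Cauchy transform and the R-transform.
\<close>

definition moment_series :: "real fps \<Rightarrow> real fps" where
  "moment_series C = C oo fps_inv (fps_X * inverse C)"

lemma
  fixes C :: "real fps"
  assumes C: "C $ 0 \<noteq> 0"
  shows moment_series_fixpoint: "moment_series C = C oo (fps_X * moment_series C)"
    and moment_series_compose: "moment_series C oo (fps_X * inverse C) = C"
proof -
  define u v where "u = fps_X * inverse C" and "v = fps_inv u"
  have u: "u $ 0 = 0" "u $ 1 \<noteq> 0"
    using C by (simp_all add: u_def)
  have v0: "v $ 0 = 0"
    by (simp add: v_def fps_inv_def)
  have vu: "v oo u = fps_X" and uv: "u oo v = fps_X"
    using u by (simp_all add: v_def fps_inv fps_inv_right)
  have M: "moment_series C = C oo v"
    by (simp add: moment_series_def u_def v_def)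
  have "fps_X = v * inverse (C oo v)"
    using uv v0 C by (simp add: u_def fps_compose_mult_distrib fps_inverse_compose)
  then have "fps_X * (C oo v) = v * (inverse (C oo v) * (C oo v))"
    by (subst mult.assoc[symmetric]) (rule arg_cong[where f = "\<lambda>F. F * (C oo v)"])
  also have "\<dots> = v"
    using C by (simp add: inverse_mult_eq_1)
  finally show "moment_series C = C oo (fps_X * moment_series C)"
    unfolding M by simp
  show "moment_series C oo (fps_X * inverse C) = C"
    unfolding M u_def[symmetric] using fps_compose_assoc[OF u(1) v0, of C] vu by simp
qed

lemma moment_series_eqI:
  assumes "C $ 0 \<noteq> 0" "M = C oo (fps_X * M)"
  shows "moment_series C = M"
  using moment_series_fixpoint[OF assms(1)] assms(2) by (rule moment_fixpoint_unique)

lemma moment_series_eqI':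
  assumes C: "C $ 0 \<noteq> 0" and M: "M oo (fps_X * inverse C) = C"
  shows "moment_series C = M"
proof -
  have "(M oo (fps_X * inverse C)) = (moment_series C oo (fps_X * inverse C))"
    using M moment_series_compose[OF C] by simp
  then show ?thesis
    using C by (subst (asm) fps_compose_inj_right) auto
qed

lemma moment_series_nth_0 [simp]:
  "C $ 0 \<noteq> 0 \<Longrightarrow> moment_series C $ 0 = C $ 0"
  by (subst moment_series_fixpoint) auto

text \<open>
  A dilation of the measure multiplies the \<open>n\<close>-th moment and the \<open>n\<close>-th free cumulant by the same factor \<open>c ^ n\<close>.
\<close>

lemma moment_series_dilate:
  assumes C: "C $ 0 \<noteq> 0"
  shows "moment_series (C oo (fps_const c * fps_X)) = moment_series C oo (fps_const c * fps_X)"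
proof (rule moment_series_eqI)
  define D M where "D = fps_const c * fps_X" and "M = moment_series C"
  have D0: "D $ 0 = 0"
    by (simp add: D_def)
  have "M oo D = (C oo (fps_X * M)) oo D"
    unfolding M_def by (subst moment_series_fixpoint[OF C]) simp
  also have "\<dots> = C oo ((fps_X * M) oo D)"
    by (rule fps_compose_assoc[symmetric]) (simp_all add: D_def)
  also have "(fps_X * M) oo D = D oo (fps_X * (M oo D))"
    using D0 unfolding D_def
    by (simp add: fps_compose_mult_distrib mult_ac)
  also have "C oo (D oo (fps_X * (M oo D))) = (C oo D) oo (fps_X * (M oo D))"
    by (rule fps_compose_assoc) (simp_all add: D_def)
  finally show "M oo D = (C oo D) oo (fps_X * (M oo D))" .
qed (use C in simp)

section \<open>Convergence of power series\<close>

text \<open>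
  Truncating the weighted \<open>\<ell>\<^sup>1\<close> norm keeps it finite for every formal series, while it is still submultiplicative. Bounds that
  are uniform in the truncation then give convergence.
\<close>

definition trunc_norm :: "real \<Rightarrow> nat \<Rightarrow> real fps \<Rightarrow> real" where
  "trunc_norm r N A = (\<Sum>n\<le>N. \<bar>A $ n\<bar> * r ^ n)"

lemma trunc_norm_nonneg: "0 \<le> r \<Longrightarrow> 0 \<le> trunc_norm r N A"
  by (simp add: trunc_norm_def sum_nonneg)

lemma trunc_norm_mult:
  assumes r: "0 \<le> r"
  shows "trunc_norm r N (A * B) \<le> trunc_norm r N A * trunc_norm r N B"
proof -
  define a b where "a i = \<bar>A $ i\<bar> * r ^ i" and "b i = \<bar>B $ i\<bar> * r ^ i" for i
  have nonneg: "0 \<le> a i" "0 \<le> b i" for i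
    using r by (simp_all add: a_def b_def)
  have "trunc_norm r N (A * B) \<le> (\<Sum>n\<le>N. \<Sum>i\<le>n. a i * b (n - i))"
    unfolding trunc_norm_def
  proof (rule sum_mono)
    fix n
    have "\<bar>(A * B) $ n\<bar> * r ^ n \<le> (\<Sum>i\<le>n. \<bar>A $ i * B $ (n - i)\<bar>) * r ^ n"
      unfolding fps_mult_nth atLeast0AtMost by (intro mult_right_mono sum_abs) (use r in simp)
    also have "\<dots> = (\<Sum>i\<le>n. a i * b (n - i))"
      unfolding sum_distrib_right
      by (intro sum.cong refl) (simp add: a_def b_def abs_mult mult_ac flip: power_add)
    finally show "\<bar>(A * B) $ n\<bar> * r ^ n \<le> (\<Sum>i\<le>n. a i * b (n - i))" .
  qed
  also have "\<dots> = (\<Sum>(i, j)\<in>{(i, j). i + j \<le> N}. a i * b j)"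
    by (rule sum.triangle_reindex_eq[symmetric])
  also have "\<dots> \<le> (\<Sum>(i, j)\<in>{..N} \<times> {..N}. a i * b j)"
    by (rule sum_mono2) (auto simp: nonneg)
  also have "\<dots> = trunc_norm r N A * trunc_norm r N B"
    by (simp add: trunc_norm_def a_def b_def sum_product sum.cartesian_product)
  finally show ?thesis .
qed

lemma trunc_norm_power:
  assumes r: "0 \<le> r"
  shows "trunc_norm r N (A ^ i) \<le> trunc_norm r N A ^ i"
proof (induction i)
  case 0
  have "trunc_norm r N 1 = (\<Sum>n\<le>N. if n = 0 then 1 else 0)"
    unfolding trunc_norm_def by (intro sum.cong) auto
  then show ?case by simp
next
  case (Suc i)
  have "trunc_norm r N (A ^ Suc i) \<le> trunc_norm r N A * trunc_norm r N (A ^ i)"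
    using trunc_norm_mult[OF r] by simp
  also have "\<dots> \<le> trunc_norm r N A * trunc_norm r N A ^ i"
    by (intro mult_left_mono Suc trunc_norm_nonneg r)
  finally show ?case by simp
qed

lemma fps_conv_radius_pos_imp_bound:
  fixes F :: "real fps"
  assumes "fps_conv_radius F > 0"
  obtains r K where "0 < r" "0 < K" "\<And>n. \<bar>F $ n\<bar> * r ^ n \<le> K"
proof -
  obtain r where r: "0 < r" "ereal r < fps_conv_radius F"
    using assms ereal_dense2[of 0 "fps_conv_radius F"] by (auto simp: zero_ereal_def)
  then have "summable (\<lambda>n. F $ n * r ^ n)"
    by (intro summable_fps) auto
  then have "Bseq (\<lambda>n. F $ n * r ^ n)"
    using summable_LIMSEQ_zero convergent_imp_Bseq convergentI by blast
  then obtain K where "K > 0" "\<And>n. \<bar>F $ n * r ^ n\<bar> \<le> K"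
    by (auto simp: Bseq_def)
  with r show ?thesis
    by (intro that[of r K]) (auto simp: abs_mult)
qed

lemma bound_imp_fps_conv_radius_pos:
  fixes F :: "real fps"
  assumes "0 < r" "\<And>n. \<bar>F $ n\<bar> * r ^ n \<le> K"
  shows "fps_conv_radius F > 0"
proof -
  have "summable (\<lambda>n. F $ n * (r / 2) ^ n)"
  proof (rule summable_comparison_test')
    show "summable (\<lambda>n. K * (1 / 2) ^ n)"
      by (intro summable_mult summable_geometric) simp
    show "norm (F $ n * (r / 2) ^ n) \<le> K * (1 / 2) ^ n" for n
      using assms(2)[of n] assms(1) by (simp add: abs_mult power_divide divide_right_mono)
  qed
  then have "ereal (norm (r / 2)) \<le> fps_conv_radius F"
    unfolding fps_conv_radius_def by (rule conv_radius_geI)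
  moreover have "0 < ereal (norm (r / 2))"
    using assms(1) by simp
  ultimately show ?thesis
    by (rule less_le_trans[rotated])
qed

text \<open>
  The coefficients of \<open>M = C \<circ> (w M)\<close> up to \<open>N + 1\<close> are controlled by those of \<open>M\<close> up to \<open>N\<close>. If \<open>C\<close> is dominated by
  a geometric series \<open>K / (1 - w / r)\<close>, then the bound \<open>2 K\<close> on the truncated norm reproduces itself, provided that the weight
  \<open>q\<close> is so small that \<open>w M\<close> has norm at most \<open>r / 2\<close>.
\<close>

lemma fps_conv_radius_moment_series:
  assumes C: "fps_conv_radius C > 0" and C0: "C $ 0 \<noteq> 0"
  shows "fps_conv_radius (moment_series C) > 0"
proof -
  define M where "M = moment_series C"
  have M: "M = C oo (fps_X * M)"
    unfolding M_def by (rule moment_series_fixpoint[OF C0])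
  have M_nth: "M $ n = (\<Sum>i\<le>n. C $ i * ((fps_X * M) ^ i) $ n)" for n
    using arg_cong[OF M, of "\<lambda>F. F $ n"] by (simp only: fps_compose_nth atLeast0AtMost)
  obtain r K where r: "0 < r" and K: "0 < K" and bound: "\<And>n. \<bar>C $ n\<bar> * r ^ n \<le> K"
    using C by (rule fps_conv_radius_pos_imp_bound) (rule that)
  define q where "q = r / (4 * K)"
  have q: "0 < q" using r K by (simp add: q_def)
  have "trunc_norm q N M \<le> 2 * K" for N
  proof (induction N)
    case 0
    show ?case
      using bound[of 0] K C0 by (simp add: trunc_norm_def M_def)
  next
    case (Suc N)
    have shift: "trunc_norm q (Suc N) (fps_X * M) = q * trunc_norm q N M"
      unfolding trunc_norm_def
      by (subst sum.atMost_Suc_shift) (simp add: sum_distrib_left mult_ac)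
    also have "\<dots> \<le> q * (2 * K)"
      using Suc.IH q by simp
    also have "\<dots> = r / 2"
      using K by (simp add: q_def)
    finally have XM: "trunc_norm q (Suc N) (fps_X * M) \<le> r / 2" .
    have "trunc_norm q (Suc N) M = (\<Sum>n\<le>Suc N. \<bar>\<Sum>i\<le>n. C $ i * ((fps_X * M) ^ i) $ n\<bar> * q ^ n)"
      by (simp only: trunc_norm_def M_nth)
    also have "\<dots> \<le> (\<Sum>n\<le>Suc N. \<Sum>i\<le>Suc N. \<bar>C $ i\<bar> * (\<bar>((fps_X * M) ^ i) $ n\<bar> * q ^ n))"
    proof (rule sum_mono)
      fix n assume n: "n \<in> {..Suc N}"
      have "\<bar>\<Sum>i\<le>n. C $ i * ((fps_X * M) ^ i) $ n\<bar> * q ^ n \<le>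
          (\<Sum>i\<le>n. \<bar>C $ i * ((fps_X * M) ^ i) $ n\<bar>) * q ^ n"
        by (intro mult_right_mono sum_abs) (use q in simp)
      also have "\<dots> = (\<Sum>i\<le>n. \<bar>C $ i\<bar> * (\<bar>((fps_X * M) ^ i) $ n\<bar> * q ^ n))"
        by (simp only: sum_distrib_right abs_mult mult.assoc)
      also have "\<dots> \<le> (\<Sum>i\<le>Suc N. \<bar>C $ i\<bar> * (\<bar>((fps_X * M) ^ i) $ n\<bar> * q ^ n))"
        by (rule sum_mono2) (use n q in auto)
      finally show "\<bar>\<Sum>i\<le>n. C $ i * ((fps_X * M) ^ i) $ n\<bar> * q ^ n \<le>
          (\<Sum>i\<le>Suc N. \<bar>C $ i\<bar> * (\<bar>((fps_X * M) ^ i) $ n\<bar> * q ^ n))" .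
    qed
    also have "\<dots> = (\<Sum>i\<le>Suc N. \<bar>C $ i\<bar> * trunc_norm q (Suc N) ((fps_X * M) ^ i))"
      unfolding trunc_norm_def sum_distrib_left by (rule sum.swap)
    also have "\<dots> \<le> (\<Sum>i\<le>Suc N. K * (1 / 2) ^ i)"
    proof (rule sum_mono)
      fix i
      have "trunc_norm q (Suc N) ((fps_X * M) ^ i) \<le> trunc_norm q (Suc N) (fps_X * M) ^ i"
        using q by (intro trunc_norm_power) simp
      also have "\<dots> \<le> (r / 2) ^ i"
        using XM q by (intro power_mono trunc_norm_nonneg) auto
      finally have "\<bar>C $ i\<bar> * trunc_norm q (Suc N) ((fps_X * M) ^ i) \<le> \<bar>C $ i\<bar> * (r / 2) ^ i"
        by (intro mult_left_mono) auto
      also have "\<dots> = \<bar>C $ i\<bar> * r ^ i * (1 / 2) ^ i"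
        by (simp add: power_divide)
      also have "\<dots> \<le> K * (1 / 2) ^ i"
        by (intro mult_right_mono bound) simp
      finally show "\<bar>C $ i\<bar> * trunc_norm q (Suc N) ((fps_X * M) ^ i) \<le> K * (1 / 2) ^ i" .
    qed
    also have "\<dots> = K * (\<Sum>i\<le>Suc N. (1 / 2) ^ i)"
      by (rule sum_distrib_left[symmetric])
    also have "(\<Sum>i\<le>Suc N. (1 / 2 :: real) ^ i) \<le> (\<Sum>i. (1 / 2) ^ i)"
      by (rule sum_le_suminf) (auto intro: summable_geometric)
    also have "\<dots> = 2"
      by (simp add: suminf_geometric)
    finally show ?case
      using K by (simp add: mult.commute)
  qed
  moreover have "\<bar>M $ n\<bar> * q ^ n \<le> trunc_norm q n M" for n
    unfolding trunc_norm_def by (rule member_le_sum) (use q in auto)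
  ultimately have "\<bar>M $ n\<bar> * q ^ n \<le> 2 * K" for n
    by (meson order_trans)
  with q show ?thesis
    unfolding M_def by (rule bound_imp_fps_conv_radius_pos)
qed

lemma has_fps_expansion_nth_0:
  assumes "f has_fps_expansion F"
  shows "F $ 0 = f 0"
  using assms eventually_nhds_x_imp_x[of "\<lambda>z. eval_fps F z = f z" 0]
  by (simp add: has_fps_expansion_def eval_fps_at_0)

text \<open>
  For small \<open>x\<close> the partial sums of \<open>G ^ k\<close> at \<open>x\<close> are bounded by \<open>\<rho> ^ k\<close> with \<open>\<rho>\<close> inside the disc of convergence of \<open>F\<close>.
  So the sum over \<open>k\<close> and the limit of the partial sums may be interchanged by dominated convergence.
\<close>

lemma has_fps_expansion_compose_real:
  fixes f g :: "real \<Rightarrow> real"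
  assumes f: "f has_fps_expansion F" and g: "g has_fps_expansion G" and G0: "G $ 0 = 0"
  shows "(\<lambda>x. f (g x)) has_fps_expansion (F oo G)"
proof -
  have radF: "fps_conv_radius F > 0" and radG: "fps_conv_radius G > 0"
    using f g by (auto simp: has_fps_expansion_def)
  obtain \<rho> where \<rho>: "0 < \<rho>" "ereal \<rho> < fps_conv_radius F"
    using radF ereal_dense2[of 0 "fps_conv_radius F"] by (auto simp: zero_ereal_def)
  have sumF: "summable (\<lambda>k. \<bar>F $ k\<bar> * \<rho> ^ k)"
    using norm_summable_fps[of \<rho> F] \<rho> by (simp add: abs_mult)
  obtain r K where r: "0 < r" and K: "0 < K" and bound: "\<And>n. \<bar>G $ n\<bar> * r ^ n \<le> K"
    using radG by (rule fps_conv_radius_pos_imp_bound) (rule that)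
  \<comment> \<open>with this weight the norm of \<open>G\<close>, which has no constant term, is at most \<open>\<rho>\<close>\<close>
  define q where "q = min (r / 2) (r * \<rho> / (2 * K))"
  have q: "0 < q" "q \<le> r / 2" "2 * K * q \<le> r * \<rho>"
    using r K \<rho>(1) by (auto simp: q_def min_def field_simps)
  have norm_G: "trunc_norm q N G \<le> \<rho>" for N
  proof -
    have "trunc_norm q N G \<le> (\<Sum>n\<le>N. K * (q / r) * (if n = 0 then 0 else (1 / 2) ^ (n - 1)))"
      unfolding trunc_norm_def
    proof (rule sum_mono)
      fix n
      show "\<bar>G $ n\<bar> * q ^ n \<le> K * (q / r) * (if n = 0 then 0 else (1 / 2) ^ (n - 1))"
      proof (cases n)
        case (Suc m)
        have "\<bar>G $ n\<bar> * q ^ n = (\<bar>G $ n\<bar> * r ^ n) * ((q / r) * (q / r) ^ m)"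
          using r by (simp add: Suc power_divide)
        also have "\<dots> \<le> K * ((q / r) * (1 / 2) ^ m)"
          using bound[of n] q r K by (intro mult_mono power_mono) (auto simp: field_simps)
        finally show ?thesis
          by (simp add: Suc mult.assoc)
      qed (simp add: G0)
    qed
    also have "\<dots> = K * (q / r) * (\<Sum>n\<le>N. if n = 0 then 0 else (1 / 2) ^ (n - 1))"
      by (rule sum_distrib_left[symmetric])
    also have "\<dots> \<le> K * (q / r) * 2"
    proof (rule mult_left_mono)
      show "(\<Sum>n\<le>N. if n = 0 then 0 else (1 / 2 :: real) ^ (n - 1)) \<le> 2"
      proof (cases N)
        case (Suc m)
        have "(\<Sum>n\<le>N. if n = 0 then 0 else (1 / 2 :: real) ^ (n - 1)) = (\<Sum>n\<le>m. (1 / 2) ^ n)"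
          unfolding Suc by (subst sum.atMost_Suc_shift) simp
        also have "\<dots> \<le> (\<Sum>i. (1 / 2) ^ i)"
          by (rule sum_le_suminf) (auto intro: summable_geometric)
        finally show ?thesis
          by (simp add: suminf_geometric)
      qed simp
    qed (use K q r in simp)
    also have "\<dots> \<le> \<rho>"
      using q(3) r by (simp add: field_simps)
    finally show ?thesis .
  qed
  have g_nhds: "eventually (\<lambda>x. ereal \<bar>x\<bar> < fps_conv_radius G \<and> eval_fps G x = g x) (nhds 0)"
  proof (rule eventually_conj)
    have "eventually (\<lambda>x. x \<in> eball 0 (fps_conv_radius G)) (nhds 0)"
      using radG by (intro eventually_nhds_in_open) (auto simp: zero_ereal_def)
    then show "eventually (\<lambda>x. ereal \<bar>x\<bar> < fps_conv_radius G) (nhds 0)"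
      by eventually_elim (simp add: in_eball_iff)
  qed (use g in \<open>simp add: has_fps_expansion_def\<close>)
  have "isCont g 0"
    using has_fps_expansion_imp_continuous[OF g, of UNIV] by simp
  moreover have g0: "g 0 = 0"
    using has_fps_expansion_nth_0[OF g] G0 by simp
  ultimately have "filterlim g (nhds 0) (nhds 0)"
    by (simp add: continuous_at tendsto_nhds_iff)
  moreover have "eventually (\<lambda>y. eval_fps F y = f y) (nhds 0)"
    using f by (simp add: has_fps_expansion_def)
  ultimately have f_g: "eventually (\<lambda>x. eval_fps F (g x) = f (g x)) (nhds 0)"
    using eventually_compose_filterlim by blast
  have small: "eventually (\<lambda>x. \<bar>x\<bar> < q) (nhds (0 :: real))"
    using eventually_nhds_in_open[of "ball 0 q" "0 :: real"] q(1) by (simp add: dist_norm)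
  have "eventually (\<lambda>x. (\<lambda>n. (F oo G) $ n * x ^ n) sums f (g x)) (nhds 0)"
    using g_nhds f_g small
  proof eventually_elim
    case (elim x)
    define a where "a k N = F $ k * (\<Sum>n\<le>N. (G ^ k) $ n * x ^ n)" for k N
    have gx: "(\<lambda>N. \<Sum>n\<le>N. (G ^ k) $ n * x ^ n) \<longlonglongrightarrow> g x ^ k" for k
    proof -
      have "ereal (norm x) < fps_conv_radius (G ^ k)"
        using elim(1) fps_conv_radius_power[of G k] by (auto intro: less_le_trans)
      then have "(\<lambda>n. (G ^ k) $ n * x ^ n) sums eval_fps (G ^ k) x"
        by (rule sums_eval_fps)
      also have "eval_fps (G ^ k) x = g x ^ k"
        using elim(1) by (simp add: eval_fps_power)
      finally show ?thesis
        by (simp add: sums_def_le)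
    qed
    have abs_le: "\<bar>\<Sum>n\<le>N. (G ^ k) $ n * x ^ n\<bar> \<le> \<rho> ^ k" for k N
    proof -
      have "\<bar>\<Sum>n\<le>N. (G ^ k) $ n * x ^ n\<bar> \<le> (\<Sum>n\<le>N. \<bar>(G ^ k) $ n * x ^ n\<bar>)"
        by (rule sum_abs)
      also have "\<dots> \<le> trunc_norm q N (G ^ k)"
        unfolding trunc_norm_def abs_mult power_abs
        using elim(3) by (intro sum_mono mult_left_mono power_mono) auto
      also have "\<dots> \<le> trunc_norm q N G ^ k"
        using q by (intro trunc_norm_power) simp
      also have "\<dots> \<le> \<rho> ^ k"
        using q by (intro power_mono norm_G trunc_norm_nonneg) simp
      finally show ?thesis .
    qed
    have "(\<lambda>N. \<Sum>k. a k N) \<longlonglongrightarrow> (\<Sum>k. F $ k * g x ^ k)"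
    proof (rule tannerys_theorem[THEN conjunct2, THEN conjunct2])
      show "(\<lambda>N. a k N) \<longlonglongrightarrow> F $ k * g x ^ k" for k
        unfolding a_def by (intro tendsto_mult tendsto_const gx)
      show "\<forall>\<^sub>F (k, N) in at_top \<times>\<^sub>F sequentially. norm (a k N) \<le> \<bar>F $ k\<bar> * \<rho> ^ k"
        using abs_le by (intro always_eventually) (auto simp: a_def abs_mult intro!: mult_left_mono)
    qed (use sumF in auto)
    moreover have "(\<Sum>k. a k N) = (\<Sum>n\<le>N. (F oo G) $ n * x ^ n)" for N
    proof -
      have vanish: "(G ^ k) $ n = 0" if "n < k" for k n
        using startsby_zero_power_prefix[OF G0] that by blast
      have "(\<Sum>k. a k N) = (\<Sum>k\<le>N. a k N)"
        by (rule suminf_finite) (auto simp: a_def vanish)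
      also have "\<dots> = (\<Sum>k\<le>N. \<Sum>n\<le>N. F $ k * (G ^ k) $ n * x ^ n)"
        by (simp add: a_def sum_distrib_left mult.assoc)
      also have "\<dots> = (\<Sum>n\<le>N. \<Sum>k\<le>N. F $ k * (G ^ k) $ n * x ^ n)"
        by (rule sum.swap)
      also have "\<dots> = (\<Sum>n\<le>N. (F oo G) $ n * x ^ n)"
      proof (rule sum.cong[OF refl])
        fix n assume "n \<in> {..N}"
        then have "(\<Sum>k\<le>N. F $ k * (G ^ k) $ n * x ^ n) = (\<Sum>k\<le>n. F $ k * (G ^ k) $ n * x ^ n)"
          by (intro sum.mono_neutral_right) (auto simp: vanish)
        then show "(\<Sum>k\<le>N. F $ k * (G ^ k) $ n * x ^ n) = (F oo G) $ n * x ^ n"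
          by (simp add: fps_compose_nth atLeast0AtMost sum_distrib_right)
      qed
      finally show ?thesis .
    qed
    ultimately have "(\<lambda>n. (F oo G) $ n * x ^ n) sums (\<Sum>k. F $ k * g x ^ k)"
      by (simp add: sums_def_le)
    also have "(\<Sum>k. F $ k * g x ^ k) = f (g x)"
      using elim(2) by (simp add: eval_fps_def)
    finally show ?case .
  qed
  then show ?thesis
    by (rule has_fps_expansionI)
qed

text \<open>
  After division by its leading power, the difference of two expansions of \<open>f\<close> represents a function that is continuous
  at \<open>0\<close> and vanishes away from \<open>0\<close>, so its leading coefficient is \<open>0\<close>.
\<close>

lemma has_fps_expansion_unique:
  fixes f :: "real \<Rightarrow> real"
  assumes F: "f has_fps_expansion F" and G: "f has_fps_expansion G"
  shows "F = G"
proof (rule ccontr)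
  assume "F \<noteq> G"
  define D n where "D = F - G" and "n = subdegree D"
  have Dn: "D $ n \<noteq> 0"
    unfolding n_def by (rule nth_subdegree_nonzero) (use \<open>F \<noteq> G\<close> in \<open>simp add: D_def\<close>)
  have "(\<lambda>x. f x - f x) has_fps_expansion D"
    unfolding D_def using F G by (rule has_fps_expansion_diff)
  then have "(\<lambda>x. if x = 0 then D $ n else (f x - f x) / x ^ n) has_fps_expansion fps_shift n D"
    by (rule has_fps_expansion_shift) (simp_all add: n_def)
  then have "isCont (\<lambda>x. if x = 0 then D $ n else (f x - f x) / x ^ n) 0"
    using has_fps_expansion_imp_continuous by blast
  then have "((\<lambda>x. if x = 0 then D $ n else (f x - f x) / x ^ n) \<longlongrightarrow> D $ n) (at 0)"
    by (simp add: isCont_def)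
  moreover have "((\<lambda>x. if x = 0 then D $ n else (f x - f x) / x ^ n) \<longlongrightarrow> 0) (at 0)"
    by (rule tendsto_eventually) (simp add: eventually_at_filter)
  ultimately have "D $ n = 0"
    by (rule tendsto_unique[rotated]) simp
  with Dn show False ..
qed

section \<open>The moment problem on a bounded interval\<close>

text \<open>
  The Bernstein weights \<open>(n choose k) y ^ k z ^ (n - k)\<close> are those of a binomial distribution; this is its \<open>j\<close>-th factorial
  moment, as an identity of polynomials.
\<close>

lemma binomial_weights_factorial_moment:
  fixes y z :: "real poly"
  assumes yz: "y + z = 1" and j: "j \<le> n"
  shows "(\<Sum>k\<le>n. of_nat ((n choose k) * (k choose j)) * (y ^ k * z ^ (n - k))) = of_nat (n choose j) * y ^ j"
proof -
  have "(\<Sum>k\<le>n. of_nat ((n choose k) * (k choose j)) * (y ^ k * z ^ (n - k))) =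
      (\<Sum>k=j..n. of_nat ((n choose k) * (k choose j)) * (y ^ k * z ^ (n - k)))"
    by (rule sum.mono_neutral_right) auto
  also have "\<dots> = (\<Sum>i\<le>n - j. of_nat ((n choose (i + j)) * ((i + j) choose j)) * (y ^ (i + j) * z ^ (n - (i + j))))"
    by (rule sum.reindex_bij_witness[of _ "\<lambda>i. i + j" "\<lambda>k. k - j"]) (use j in auto)
  also have "\<dots> = (\<Sum>i\<le>n - j. of_nat (n choose j) * y ^ j * (of_nat ((n - j) choose i) * y ^ i * z ^ (n - j - i)))"
  proof (rule sum.cong[OF refl])
    fix i assume "i \<in> {..n - j}"
    then have "(n choose (i + j)) * ((i + j) choose j) = (n choose j) * ((n - j) choose i)"
      using choose_mult[of j "i + j" n] j by simp
    then show "of_nat ((n choose (i + j)) * ((i + j) choose j)) * (y ^ (i + j) * z ^ (n - (i + j))) =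
        of_nat (n choose j) * y ^ j * (of_nat ((n - j) choose i) * y ^ i * z ^ (n - j - i))"
      by (simp add: power_add mult_ac add.commute)
  qed
  also have "\<dots> = of_nat (n choose j) * y ^ j * (y + z) ^ (n - j)"
    unfolding binomial_ring sum_distrib_left ..
  finally show ?thesis
    by (simp add: yz)
qed

text \<open>
  Passing from \<open>j\<close> to \<open>j + 1\<close> multiplies the two quantities by \<open>(k - j) / (n - j)\<close> and \<open>k / n\<close>, which differ by at most
  \<open>j / (n - j)\<close>, and \<open>j\<^sup>2 + j \<le> (j + 1)\<^sup>2\<close>.
\<close>

lemma choose_ratio_approx:
  assumes "j < n" "k \<le> n"
  shows "\<bar>real (k choose j) / real (n choose j) - (real k / real n) ^ j\<bar> \<le> real j ^ 2 / real (n - j)"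
  using assms(1)
proof (induction j)
  case (Suc j)
  define a b c d where "a = real (k choose j) / real (n choose j)" and "b = (real k - real j) / (real n - real j)"
    and "c = (real k / real n) ^ j" and "d = real k / real n"
  have jn: "real j < real n" "j < n"
    using Suc.prems by simp_all
  have choose_Suc: "real (m choose Suc j) = real (m choose j) * (real m - real j) / real (Suc j)" for m
  proof (cases "j \<le> m")
    case True
    have "Suc j * (m choose Suc j) = (m - j) * (m choose j)"
      by (simp only: binomial_absorption binomial_absorb_comp)
    then have "real (Suc j) * real (m choose Suc j) = (real m - real j) * real (m choose j)"
      using True by (metis of_nat_diff of_nat_mult)
    then show ?thesis
      by (simp add: field_simps del: of_nat_Suc)
  qed (simp add: binomial_eq_0)
  have ab: "real (k choose Suc j) / real (n choose Suc j) = a * b"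
    unfolding choose_Suc a_def b_def times_divide_times_eq by (simp del: of_nat_Suc)
  have a: "0 \<le> a" "a \<le> 1"
    using assms(2) jn by (auto simp: a_def divide_le_eq binomial_right_mono)
  have d: "0 \<le> d" "d \<le> 1"
    using assms(2) jn by (auto simp: d_def divide_le_eq)
  have "d - b = real j * (real n - real k) / (real n * (real n - real j))"
    using jn by (simp add: b_def d_def field_simps)
  moreover have "0 \<le> real j * (real n - real k) / (real n * (real n - real j))"
    using jn assms(2) by (intro divide_nonneg_nonneg mult_nonneg_nonneg) auto
  moreover have "real j * (real n - real k) / (real n * (real n - real j)) \<le>
      real j * real n / (real n * (real n - real j))"
    using jn assms(2) by (intro divide_right_mono mult_left_mono mult_nonneg_nonneg) auto
  moreover have "real j * real n / (real n * (real n - real j)) = real j / (real n - real j)"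
    using jn by simp
  ultimately have bd: "\<bar>b - d\<bar> \<le> real j / (real n - real j)"
    by linarith
  have "a * b - c * d = a * (b - d) + d * (a - c)"
    by (simp add: algebra_simps)
  then have "\<bar>a * b - c * d\<bar> \<le> a * \<bar>b - d\<bar> + d * \<bar>a - c\<bar>"
    using abs_triangle_ineq[of "a * (b - d)" "d * (a - c)"] a d by (simp add: abs_mult)
  also have "\<dots> \<le> 1 * (real j / (real n - real j)) + 1 * (real j ^ 2 / (real n - real j))"
    using a d bd Suc.IH jn by (intro add_mono mult_mono) (auto simp: a_def c_def of_nat_diff)
  also have "\<dots> = (real j + real j ^ 2) / (real n - real j)"
    by (simp add: add_divide_distrib)
  also have "\<dots> \<le> real (Suc j) ^ 2 / real (n - Suc j)"
    using Suc.prems by (intro frac_le) (auto simp: power2_eq_square of_nat_diff algebra_simps)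
  finally show ?case
    unfolding ab by (simp add: c_def d_def mult.commute)
qed simp

text \<open>
  The values of \<open>L\<close> on the Bernstein polynomials of degree \<open>n\<close> are nonnegative and sum to \<open>1\<close>. Placing them as masses at the
  points \<open>k / n\<close> gives probability measures on \<open>[0, 1]\<close>, whose moments tend to those of \<open>L\<close> by the two preceding lemmas. A
  weak limit, which exists by Helly's theorem, represents \<open>L\<close>.
\<close>

lemma hausdorff_moment_problem:
  fixes L :: "real poly \<Rightarrow> real"
  assumes add: "\<And>p q. L (p + q) = L p + L q" and smult: "\<And>c p. L (smult c p) = c * L p"
    and L1: "L 1 = 1" and pos: "\<And>j k. 0 \<le> L ([:0, 1:] ^ j * [:1, -1:] ^ k)"
  obtains \<mu> where "real_distribution \<mu>" "AE x in \<mu>. x \<in> {0..1}" "\<And>n. (LINT x|\<mu>. x ^ n) = L ([:0, 1:] ^ n)"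
proof -
  define y z :: "real poly" where "y = [:0, 1:]" and "z = [:1, -1:]"
  have yz: "y + z = 1"
    by (simp add: y_def z_def one_pCons)
  have L0: "L 0 = 0"
    using smult[of 0 0] by simp
  have L_sum: "L (\<Sum>i\<in>I. g i) = (\<Sum>i\<in>I. L (g i))" if "finite I" for I :: "nat set" and g
    using that by (induction I) (auto simp: L0 add)
  have L_nat: "L (of_nat m * p) = real m * L p" for m p
    using smult[of "real m" p] by (simp add: of_nat_poly)
  define w where "w n k = real (n choose k) * L (y ^ k * z ^ (n - k))" for n k
  have w_nonneg: "0 \<le> w n k" for n k
    using pos[of k "n - k"] by (simp add: w_def y_def z_def)
  have w_moment: "(\<Sum>k\<le>n. w n k * real (k choose j)) = real (n choose j) * L (y ^ j)" if "j \<le> n" for n j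
  proof -
    have "(\<Sum>k\<le>n. w n k * real (k choose j)) =
        L (\<Sum>k\<le>n. of_nat ((n choose k) * (k choose j)) * (y ^ k * z ^ (n - k)))"
      by (simp only: L_sum finite_atMost L_nat of_nat_mult mult_ac w_def)
         (intro sum.cong refl, metis L_nat mult.assoc mult.left_commute)
    also have "\<dots> = real (n choose j) * L (y ^ j)"
      by (simp only: binomial_weights_factorial_moment[OF yz that] L_nat)
    finally show ?thesis .
  qed
  have w_sum: "(\<Sum>k\<le>n. w n k) = 1" for n
    using w_moment[of 0 n] L1 by simp
  define p where "p n = embed_pmf (\<lambda>k. if k \<le> n then w n k else 0)" for n
  have pmf_p: "pmf (p n) k = (if k \<le> n then w n k else 0)" for n k
    unfolding p_def
  proof (rule pmf_embed_pmf)
    have "(\<integral>\<^sup>+ k. ennreal (if k \<le> n then w n k else 0) \<partial>count_space UNIV) =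
        (\<Sum>k\<le>n. ennreal (if k \<le> n then w n k else 0))"
      by (subst nn_integral_count_space'[of "{..n}"]) auto
    also have "\<dots> = 1"
      using w_sum[of n] by (simp add: sum_ennreal w_nonneg)
    finally show "(\<integral>\<^sup>+ k. ennreal (if k \<le> n then w n k else 0) \<partial>count_space UNIV) = 1" .
  qed (simp add: w_nonneg)
  define \<mu> where "\<mu> n = distr (measure_pmf (p n)) borel (\<lambda>k. real k / real n)" for n
  have \<mu>: "real_distribution (\<mu> n)" for n
    unfolding \<mu>_def real_distribution_def real_distribution_axioms_def
    by (auto intro!: measure_pmf.prob_space_distr)
  have set_p: "k \<le> n" if "k \<in> set_pmf (p n)" for k n
    using that by (auto simp: set_pmf_iff pmf_p split: if_splits)
  have AE_\<mu>: "AE x in \<mu> n. x \<in> {0..1}" for n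
    unfolding \<mu>_def
    by (subst AE_distr_iff) (auto simp: AE_measure_pmf_iff divide_le_eq dest: set_p)
  have int_\<mu>: "(LINT x|\<mu> n. f x) = (\<Sum>k\<le>n. w n k * f (real k / real n))" if "f \<in> borel_measurable borel" for n and f :: "real \<Rightarrow> real"
  proof -
    have "(LINT x|\<mu> n. f x) = (LINT k|measure_pmf (p n). f (real k / real n))"
      unfolding \<mu>_def by (rule integral_distr) (use that in auto)
    also have "\<dots> = (\<Sum>k\<le>n. pmf (p n) k *\<^sub>R f (real k / real n))"
      by (rule integral_measure_pmf) (auto dest: set_p)
    finally show ?thesis
      by (simp add: pmf_p)
  qed
  have lim_moment: "(\<lambda>n. \<Sum>k\<le>n. w n k * (real k / real n) ^ j) \<longlonglongrightarrow> L (y ^ j)" for j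
  proof (rule Lim_null_comparison[THEN LIM_zero_cancel])
    show "eventually (\<lambda>n. norm ((\<Sum>k\<le>n. w n k * (real k / real n) ^ j) - L (y ^ j)) \<le> real j ^ 2 / real (n - j)) sequentially"
      using eventually_gt_at_top[of j]
    proof eventually_elim
      case (elim n)
      have "L (y ^ j) = (\<Sum>k\<le>n. w n k * (real (k choose j) / real (n choose j)))"
        using w_moment[of j n] elim by (simp add: sum_divide_distrib[symmetric])
      then have "(\<Sum>k\<le>n. w n k * (real k / real n) ^ j) - L (y ^ j) =
          (\<Sum>k\<le>n. w n k * ((real k / real n) ^ j - real (k choose j) / real (n choose j)))"
        by (simp add: sum_subtractf right_diff_distrib)
      also have "norm \<dots> \<le> (\<Sum>k\<le>n. w n k * (real j ^ 2 / real (n - j)))"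
      proof (rule sum_norm_le)
        fix k assume "k \<in> {..n}"
        then have "\<bar>(real k / real n) ^ j - real (k choose j) / real (n choose j)\<bar> \<le> real j ^ 2 / real (n - j)"
          using choose_ratio_approx[OF elim, of k] by (simp add: abs_minus_commute)
        then show "norm (w n k * ((real k / real n) ^ j - real (k choose j) / real (n choose j))) \<le>
            w n k * (real j ^ 2 / real (n - j))"
          unfolding real_norm_def abs_mult abs_of_nonneg[OF w_nonneg]
          by (intro mult_left_mono w_nonneg)
      qed
      also have "\<dots> = real j ^ 2 / real (n - j)"
        using w_sum[of n] by (simp add: sum_distrib_right[symmetric] sum_divide_distrib[symmetric])
      finally show ?case .
    qed
    have "(\<lambda>n. real j ^ 2 / real n) \<longlonglongrightarrow> 0"
      by (rule lim_const_over_n)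
    then show "(\<lambda>n. real j ^ 2 / real (n - j)) \<longlonglongrightarrow> 0"
      by (rule filterlim_compose) (rule filterlim_minus_const_nat_at_top)
  qed
  have "tight \<mu>"
    unfolding tight_def
  proof (intro conjI allI impI \<mu>)
    fix \<epsilon> :: real assume "0 < \<epsilon>"
    have "measure (\<mu> n) {-1<..1} = 1" for n
    proof -
      interpret real_distribution "\<mu> n" by (rule \<mu>)
      show ?thesis
        using AE_\<mu>[of n] by (intro prob_eq_1[THEN iffD2]) auto
    qed
    with \<open>0 < \<epsilon>\<close> show "\<exists>a b. a < b \<and> (\<forall>n. 1 - \<epsilon> < measure (\<mu> n) {a<..b})"
      by (intro exI[of _ "-1"] exI[of _ 1]) auto
  qed
  then obtain r M where r: "strict_mono (r :: nat \<Rightarrow> nat)" and M: "real_distribution M"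
    and conv: "weak_conv_m (\<mu> \<circ> id \<circ> r) M"
    using tight_imp_convergent_subsubsequence[of \<mu> id] by (auto simp: strict_mono_def)
  interpret M: real_distribution M by fact
  have lim_int: "(\<lambda>n. LINT x|\<mu> (r n). f x) \<longlonglongrightarrow> (LINT x|M. f x)"
    if "\<And>x. isCont f x" "\<And>x. norm (f x) \<le> 1" for f :: "real \<Rightarrow> real"
  proof -
    have "(\<lambda>n. integral\<^sup>L ((\<mu> \<circ> id \<circ> r) n) f) \<longlonglongrightarrow> integral\<^sup>L M f"
      by (rule weak_conv_imp_integral_bdd_continuous_conv[OF _ M conv that]) (simp add: \<mu>)
    then show ?thesis by simp
  qed
  \<comment> \<open>weak convergence tests only bounded functions, so powers are cut off outside \<open>[0, 1]\<close>\<close>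
  define clamp :: "real \<Rightarrow> real" where "clamp x = max 0 (min 1 x)" for x
  have clamp_cont: "isCont clamp x" for x
    unfolding clamp_def by (intro continuous_intros)
  have clamp_meas [measurable]: "clamp \<in> borel_measurable borel"
    unfolding clamp_def by measurable
  have clamp_le: "0 \<le> clamp x" "clamp x \<le> 1" for x
    by (auto simp: clamp_def)
  have clamp_id: "clamp x = x" if "x \<in> {0..1}" for x
    using that by (auto simp: clamp_def)
  have clamp_moment: "(LINT x|M. clamp x ^ j) = L (y ^ j)" for j
  proof -
    have "(\<lambda>n. LINT x|\<mu> (r n). clamp x ^ j) \<longlonglongrightarrow> (LINT x|M. clamp x ^ j)"
      by (rule lim_int) (use clamp_cont clamp_le in \<open>auto intro!: continuous_intros power_le_one\<close>)
    moreover have "(LINT x|\<mu> n. clamp x ^ j) = (\<Sum>k\<le>n. w n k * (real k / real n) ^ j)" for n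
    proof (subst int_\<mu>)
      show "(\<Sum>k\<le>n. w n k * clamp (real k / real n) ^ j) = (\<Sum>k\<le>n. w n k * (real k / real n) ^ j)"
        by (intro sum.cong refl) (auto simp: clamp_id divide_le_eq)
    qed measurable
    ultimately have "(\<lambda>n. \<Sum>k\<le>r n. w (r n) k * (real k / real (r n)) ^ j) \<longlonglongrightarrow> (LINT x|M. clamp x ^ j)"
      by simp
    moreover have "(\<lambda>n. \<Sum>k\<le>r n. w (r n) k * (real k / real (r n)) ^ j) \<longlonglongrightarrow> L (y ^ j)"
      using LIMSEQ_subseq_LIMSEQ[OF lim_moment r] by (simp add: o_def)
    ultimately show ?thesis
      by (rule LIMSEQ_unique)
  qed
  \<comment> \<open>a bounded continuous function that vanishes exactly on \<open>[0, 1]\<close> and so detects the support\<close>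
  define h :: "real \<Rightarrow> real" where "h x = min 1 \<bar>x - clamp x\<bar>" for x
  have h_cont: "isCont h x" for x
    unfolding h_def by (intro continuous_intros clamp_cont)
  have h_meas [measurable]: "h \<in> borel_measurable borel"
    unfolding h_def by measurable
  have h_le: "0 \<le> h x" "h x \<le> 1" for x
    by (auto simp: h_def)
  have "(\<lambda>n. LINT x|\<mu> (r n). h x) \<longlonglongrightarrow> (LINT x|M. h x)"
    by (rule lim_int) (use h_cont h_le in auto)
  moreover have "(LINT x|\<mu> n. h x) = 0" for n
    using AE_\<mu>[of n] by (intro integral_eq_zero_AE) (auto simp: h_def clamp_id)
  ultimately have "(LINT x|M. h x) = 0"
    by (simp add: LIMSEQ_const_iff)
  moreover have "integrable M h"
    by (rule M.integrable_const_bound[of _ 1]) (use h_le in auto)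
  ultimately have "AE x in M. h x = 0"
    using integral_nonneg_eq_0_iff_AE[of M h] h_le by simp
  then have AE_M: "AE x in M. x \<in> {0..1}"
    by eventually_elim (auto simp: h_def clamp_def min_def max_def split: if_splits)
  have "(LINT x|M. x ^ n) = L (y ^ n)" for n
  proof -
    have "(LINT x|M. x ^ n) = (LINT x|M. clamp x ^ n)"
      using AE_M by (intro integral_cong_AE) (auto simp: clamp_id)
    then show ?thesis
      by (simp add: clamp_moment)
  qed
  with M AE_M show ?thesis
    by (intro that[of M]) (auto simp: y_def)
qed

lemma pcompose_power: "pcompose (p ^ n) q = pcompose p q ^ n" for p q :: "real poly"
  by (induction n) (simp_all add: pcompose_mult pcompose_1)

definition moment_functional :: "(nat \<Rightarrow> real) \<Rightarrow> real poly \<Rightarrow> real" where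
  "moment_functional s p = (\<Sum>i\<le>degree p. coeff p i * s i)"

lemma moment_functional_eq:
  assumes "degree p \<le> n"
  shows "moment_functional s p = (\<Sum>i\<le>n. coeff p i * s i)"
  unfolding moment_functional_def
  by (rule sum.mono_neutral_left) (use assms in \<open>auto simp: coeff_eq_0\<close>)

lemma moment_functional_add:
  "moment_functional s (p + q) = moment_functional s p + moment_functional s q"
  using moment_functional_eq[of "p + q" "max (degree p) (degree q)" s]
    moment_functional_eq[of p "max (degree p) (degree q)" s]
    moment_functional_eq[of q "max (degree p) (degree q)" s]
  by (simp add: degree_add_le_max sum.distrib algebra_simps)

lemma moment_functional_smult:
  "moment_functional s (smult c p) = c * moment_functional s p"
  by (cases "c = 0") (simp_all add: moment_functional_def sum_distrib_left mult.assoc)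

lemma moment_functional_monom: "moment_functional s (monom c n) = c * s n"
  using moment_functional_eq[of "monom c n" n s]
  by (simp add: degree_monom_le if_distrib[of "\<lambda>x. x * _"] cong: if_cong)

lemma moment_functional_sum:
  "finite I \<Longrightarrow> moment_functional s (\<Sum>i\<in>I. f i) = (\<Sum>i\<in>I. moment_functional s (f i))"
  by (induction I rule: finite_induct) (simp_all add: moment_functional_add, simp add: moment_functional_def)

lemma moment_functional_mult:
  "moment_functional s (p * q) = (\<Sum>i\<le>degree p. \<Sum>j\<le>degree q. coeff p i * coeff q j * s (i + j))"
proof -
  have "p * q = (\<Sum>i\<le>degree p. monom (coeff p i) i) * (\<Sum>j\<le>degree q. monom (coeff q j) j)"
    by (simp only: poly_as_sum_of_monoms)
  also have "\<dots> = (\<Sum>i\<le>degree p. \<Sum>j\<le>degree q. monom (coeff p i * coeff q j) (i + j))"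
    by (simp only: sum_product mult_monom)
  finally have "p * q = (\<Sum>i\<le>degree p. \<Sum>j\<le>degree q. monom (coeff p i * coeff q j) (i + j))" .
  then show ?thesis
    by (simp only: moment_functional_sum finite_atMost moment_functional_monom)
qed

lemma moment_functional_square_nonneg:
  assumes "hankel_psd s"
  shows "0 \<le> moment_functional s (p\<^sup>2)"
  using assms unfolding hankel_psd_def power2_eq_square moment_functional_mult
  by (simp only: lessThan_Suc_atMost[symmetric])

lemma moment_functional_Cauchy_Schwarz:
  assumes "hankel_psd s"
  shows "(moment_functional s (p * q))\<^sup>2 \<le> moment_functional s (p\<^sup>2) * moment_functional s (q\<^sup>2)"
proof -
  let ?L = "moment_functional s"
  have quadratic: "0 \<le> ?L (p\<^sup>2) + 2 * t * ?L (p * q) + t\<^sup>2 * ?L (q\<^sup>2)" for t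
  proof -
    have "(p + smult t q)\<^sup>2 = p\<^sup>2 + smult (2 * t) (p * q) + smult (t\<^sup>2) (q\<^sup>2)"
      unfolding mult_2 smult_add_left by (simp add: power2_eq_square algebra_simps)
    then show ?thesis
      using moment_functional_square_nonneg[OF assms, of "p + smult t q"]
      by (simp add: moment_functional_add moment_functional_smult)
  qed
  show ?thesis
  proof (cases "?L (q\<^sup>2) = 0")
    case True
    have "?L (p * q) = 0"
    proof (rule ccontr)
      assume "?L (p * q) \<noteq> 0"
      then show False
        using quadratic[of "- (?L (p\<^sup>2) + 1) / (2 * ?L (p * q))"] True by (simp add: field_simps)
    qed
    with True show ?thesis by simp
  next
    case False
    then have "0 < ?L (q\<^sup>2)"
      using moment_functional_square_nonneg[OF assms, of q] by simp
    then show ?thesis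
      using quadratic[of "- ?L (p * q) / ?L (q\<^sup>2)"]
      by (simp add: power2_eq_square field_simps)
  qed
qed

text \<open>
  A log-convex sequence has increasing ratios. If the first ratio exceeded \<open>q\<close>, the sequence would outgrow \<open>K q ^ n\<close>.
\<close>

lemma log_convex_growth:
  fixes a :: "nat \<Rightarrow> real"
  assumes nonneg: "\<And>n. 0 \<le> a n" and convex: "\<And>n. (a (Suc n))\<^sup>2 \<le> a n * a (Suc (Suc n))"
    and bound: "\<And>n. a n \<le> K * q ^ n" and q: "0 < q"
  shows "a 1 \<le> q * a 0"
proof (rule ccontr)
  assume "\<not> a 1 \<le> q * a 0"
  then have less: "q * a 0 < a 1" by simp
  then have a1: "0 < a 1"
    using nonneg[of 0] q by (smt (verit) mult_nonneg_nonneg)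
  have a0: "0 < a 0"
  proof (rule ccontr)
    assume "\<not> 0 < a 0"
    then have "a 0 = 0" using nonneg[of 0] by simp
    with convex[of 0] a1 show False by simp
  qed
  define \<rho> where "\<rho> = a 1 / a 0"
  have \<rho>: "q < \<rho>"
    using less a0 by (simp add: \<rho>_def field_simps)
  have step: "0 < a n \<and> \<rho> * a n \<le> a (Suc n)" for n
  proof (induction n)
    case 0
    then show ?case using a0 by (simp add: \<rho>_def)
  next
    case (Suc n)
    then have pos: "0 < a (Suc n)"
      using \<rho> q by (smt (verit) mult_pos_pos)
    have "\<rho> * a n * a (Suc n) \<le> a (Suc n) * a (Suc n)"
      using Suc pos by (intro mult_right_mono) auto
    also have "\<dots> \<le> a n * a (Suc (Suc n))"
      using convex[of n] by (simp add: power2_eq_square)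
    finally have "a n * (\<rho> * a (Suc n)) \<le> a n * a (Suc (Suc n))"
      by (simp add: mult_ac)
    with Suc pos show ?case by simp
  qed
  have grow: "a 0 * \<rho> ^ n \<le> a n" for n
  proof (induction n)
    case (Suc n)
    have "a 0 * \<rho> ^ Suc n = \<rho> * (a 0 * \<rho> ^ n)" by simp
    also have "\<dots> \<le> \<rho> * a n"
      using Suc \<rho> q by (intro mult_left_mono) auto
    also have "\<dots> \<le> a (Suc n)" using step by blast
    finally show ?case .
  qed simp
  obtain n where "K / a 0 < (\<rho> / q) ^ n"
    using real_arch_pow[of "\<rho> / q" "K / a 0"] \<rho> q by auto
  then have "K * q ^ n < a 0 * \<rho> ^ n"
    using a0 q by (simp add: power_divide field_simps)
  then show False
    using grow[of n] bound[of n] by linarith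
qed

text \<open>
  By Cauchy-Schwarz the sequence \<open>L (x ^ (2 n) p\<^sup>2)\<close> is log-convex in \<open>n\<close>, and the bound on \<open>s\<close> limits its growth to
  \<open>R ^ (2 n)\<close>. Hence \<open>L (x\<^sup>2 p\<^sup>2) \<le> R\<^sup>2 L (p\<^sup>2)\<close>.
\<close>

lemma moment_functional_bounded_support:
  assumes psd: "hankel_psd s" and R: "0 < R" and bound: "\<And>n. \<bar>s n\<bar> \<le> K * R ^ n"
  shows "0 \<le> moment_functional s ([:R\<^sup>2, 0, -1:] * p\<^sup>2)"
proof -
  let ?L = "moment_functional s"
  define a where "a n = ?L ((monom 1 n * p)\<^sup>2)" for n
  define B where "B = (\<Sum>i\<le>degree p. \<Sum>j\<le>degree p. \<bar>coeff p i * coeff p j\<bar> * (K * R ^ (i + j)))"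
  have sq: "(monom 1 n * p)\<^sup>2 = monom 1 (2 * n) * p\<^sup>2" for n
    by (simp add: power_mult_distrib power2_eq_square mult_monom mult_2)
  have "a 1 \<le> R\<^sup>2 * a 0"
  proof (rule log_convex_growth)
    show "0 \<le> a n" for n
      unfolding a_def by (rule moment_functional_square_nonneg[OF psd])
    show "(a (Suc n))\<^sup>2 \<le> a n * a (Suc (Suc n))" for n
    proof -
      have "(monom 1 n * p) * (monom 1 (Suc (Suc n)) * p) = (monom 1 (Suc n) * p)\<^sup>2"
        by (simp add: power2_eq_square mult_monom mult_ac flip: mult.assoc)
      then show ?thesis
        unfolding a_def by (metis moment_functional_Cauchy_Schwarz[OF psd])
    qed
    show "a n \<le> B * (R\<^sup>2) ^ n" for n
    proof -
      have "a n = (\<Sum>i\<le>degree p. \<Sum>j\<le>degree p. coeff p i * coeff p j * s (2 * n + (i + j)))"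
      proof -
        have "monom 1 (2 * n) * (p * p) = monom 1 (2 * n) *
            ((\<Sum>i\<le>degree p. monom (coeff p i) i) * (\<Sum>j\<le>degree p. monom (coeff p j) j))"
          by (simp only: poly_as_sum_of_monoms)
        also have "\<dots> = (\<Sum>i\<le>degree p. \<Sum>j\<le>degree p. monom (coeff p i * coeff p j) (2 * n + (i + j)))"
          unfolding sum_product unfolding sum_distrib_left mult_monom by simp
        finally have "monom 1 (2 * n) * (p * p) =
            (\<Sum>i\<le>degree p. \<Sum>j\<le>degree p. monom (coeff p i * coeff p j) (2 * n + (i + j)))" .
        then show ?thesis
          unfolding a_def sq unfolding power2_eq_square
          by (simp only: moment_functional_sum finite_atMost moment_functional_monom)
      qed
      also have "\<dots> \<le> (\<Sum>i\<le>degree p. \<Sum>j\<le>degree p. \<bar>coeff p i * coeff p j\<bar> * (K * R ^ (2 * n + (i + j))))"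
      proof (intro sum_mono)
        fix i j
        have "coeff p i * coeff p j * s (2 * n + (i + j)) \<le> \<bar>coeff p i * coeff p j\<bar> * \<bar>s (2 * n + (i + j))\<bar>"
          by (metis abs_ge_self abs_mult)
        also have "\<dots> \<le> \<bar>coeff p i * coeff p j\<bar> * (K * R ^ (2 * n + (i + j)))"
          by (intro mult_left_mono bound) simp
        finally show "coeff p i * coeff p j * s (2 * n + (i + j)) \<le>
            \<bar>coeff p i * coeff p j\<bar> * (K * R ^ (2 * n + (i + j)))" .
      qed
      also have "\<dots> = B * (R\<^sup>2) ^ n"
        unfolding B_def sum_distrib_right
        by (simp add: power_add mult_ac flip: power_mult)
      finally show ?thesis .
    qed
  qed (use R in simp)
  moreover have "[:R\<^sup>2, 0, -1:] * p\<^sup>2 = smult (R\<^sup>2) ((monom 1 0 * p)\<^sup>2) + smult (-1) ((monom 1 1 * p)\<^sup>2)"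
  proof -
    have "[:R\<^sup>2, 0, -1:] = smult (R\<^sup>2) (monom 1 0) + smult (-1) (monom 1 2)"
      by (simp add: monom_altdef power2_eq_square)
    then show ?thesis
      unfolding sq by (simp only: distrib_right mult_smult_left mult_2 one_add_one[symmetric] mult_1_right add_0 mult_zero_right)
  qed
  ultimately show ?thesis
    by (simp only: moment_functional_add moment_functional_smult a_def)
qed

text \<open>
  The functional is nonnegative on \<open>p\<^sup>2\<close> and \<open>(R\<^sup>2 - x\<^sup>2) p\<^sup>2\<close>, hence also on \<open>(R \<plusminus> x) p\<^sup>2\<close>, since
  \<open>2 R (R \<plusminus> x) = (R \<plusminus> x)\<^sup>2 + (R\<^sup>2 - x\<^sup>2)\<close>. Splitting exponents by parity, it is nonnegative on
  all products \<open>(R + x) ^ j (R - x) ^ k\<close>, and an affine change of variable reduces the claim to the interval \<open>[0, 1]\<close>.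
\<close>

theorem hamburger_moment_problem_bounded:
  assumes psd: "hankel_psd s" and s0: "s 0 = 1" and R: "0 < R" and bound: "\<And>n. \<bar>s n\<bar> \<le> K * R ^ n"
  obtains \<mu> where "real_distribution \<mu>" "AE x in \<mu>. \<bar>x\<bar> \<le> R" "\<And>n. (LINT x|\<mu>. x ^ n) = s n"
proof -
  let ?L = "moment_functional s"
  have sq: "0 \<le> ?L (p\<^sup>2)" for p
    by (rule moment_functional_square_nonneg[OF psd])
  have both: "0 \<le> ?L ([:R, 1:] * [:R, -1:] * p\<^sup>2)" for p
  proof -
    have "[:R, 1:] * [:R, -1:] = [:R\<^sup>2, 0, -1:]"
      by (simp add: power2_eq_square)
    then show ?thesis
      using moment_functional_bounded_support[OF psd R bound, of p] by simp
  qed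
  have one: "0 \<le> ?L (u * p\<^sup>2)" if uv: "u + v = [:2 * R:]" "\<And>p. 0 \<le> ?L (u * v * p\<^sup>2)" for u v p
  proof -
    have "smult (2 * R) (u * p\<^sup>2) = [:2 * R:] * (u * p\<^sup>2)"
      by simp
    also have "\<dots> = (u * p)\<^sup>2 + u * v * p\<^sup>2"
      unfolding uv(1)[symmetric] by (simp add: power2_eq_square algebra_simps)
    finally have "2 * R * ?L (u * p\<^sup>2) = ?L ((u * p)\<^sup>2) + ?L (u * v * p\<^sup>2)"
      by (simp only: moment_functional_add[symmetric] moment_functional_smult[symmetric])
    then have "0 \<le> 2 * R * ?L (u * p\<^sup>2)"
      using sq[of "u * p"] uv(2)[of p] by linarith
    then show ?thesis
      using R by (simp add: zero_le_mult_iff)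
  qed
  have plus: "0 \<le> ?L ([:R, 1:] * p\<^sup>2)" for p
    by (rule one[of _ "[:R, -1:]"]) (use both in auto)
  have minus: "0 \<le> ?L ([:R, -1:] * p\<^sup>2)" for p
    by (rule one[of _ "[:R, 1:]"]) (use both in \<open>auto simp: mult.commute\<close>)
  have weights: "0 \<le> ?L ([:R, 1:] ^ j * [:R, -1:] ^ k)" for j k
  proof -
    define p where "p = [:R, 1:] ^ (j div 2) * [:R, -1:] ^ (k div 2)"
    have half: "u ^ m = u ^ (m mod 2) * (u ^ (m div 2))\<^sup>2" for u :: "real poly" and m
      by (metis mod_mult_div_eq mult.commute power_add power_mult)
    have eq: "[:R, 1:] ^ j * [:R, -1:] ^ k = [:R, 1:] ^ (j mod 2) * [:R, -1:] ^ (k mod 2) * p\<^sup>2"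
      by (subst (1 2) half) (simp add: p_def power_mult_distrib mult_ac)
    consider "j mod 2 = 0" "k mod 2 = 0" | "j mod 2 = 1" "k mod 2 = 0"
      | "j mod 2 = 0" "k mod 2 = 1" | "j mod 2 = 1" "k mod 2 = 1"
      by (metis mod2_eq_if)
    then show ?thesis
      unfolding eq using sq[of p] plus[of p] minus[of p] both[of p]
      by cases (simp_all only: power_0 power_one_right mult_1_left mult_1_right)
  qed
  \<comment> \<open>the affine map from \<open>[-R, R]\<close> onto \<open>[0, 1]\<close>, with inverse \<open>X\<close> below\<close>
  define Y where "Y = [:1 / 2, 1 / (2 * R):]"
  have Y1: "1 - Y = smult (1 / (2 * R)) [:R, -1:]" and Y: "Y = smult (1 / (2 * R)) [:R, 1:]"
    using R by (simp_all add: Y_def one_pCons)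
  obtain \<mu> where \<mu>: "real_distribution \<mu>" and AE_\<mu>: "AE x in \<mu>. x \<in> {0..1}"
    and moment_\<mu>: "\<And>n. (LINT x|\<mu>. x ^ n) = ?L (pcompose ([:0, 1:] ^ n) Y)"
  proof (rule hausdorff_moment_problem[of "\<lambda>p. ?L (pcompose p Y)"])
    show "0 \<le> ?L (pcompose ([:0, 1:] ^ j * [:1, -1:] ^ k) Y)" for j k
    proof -
      have "pcompose ([:0, 1:] ^ j * [:1, -1:] ^ k) Y = Y ^ j * (1 - Y) ^ k"
        by (simp add: pcompose_mult pcompose_power pcompose_pCons one_pCons)
      also have "\<dots> = smult ((1 / (2 * R)) ^ j * (1 / (2 * R)) ^ k) ([:R, 1:] ^ j * [:R, -1:] ^ k)"
        unfolding Y1 unfolding Y smult_power by (simp add: mult_ac)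
      finally show ?thesis
        using weights[of j k] R by (simp add: moment_functional_smult)
    qed
    show "?L (pcompose 1 Y) = 1"
      using moment_functional_monom[of s 1 0] s0 by (simp add: pcompose_1)
  qed (auto simp: pcompose_add pcompose_smult moment_functional_add moment_functional_smult)
  interpret \<mu>: real_distribution \<mu> by fact
  have pow_int: "integrable \<mu> (\<lambda>x. x ^ n)" for n
    by (rule \<mu>.integrable_const_bound[of _ 1]) (use AE_\<mu> in \<open>auto simp: power_abs intro!: power_le_one\<close>)
  have poly_int: "(LINT x|\<mu>. poly p x) = ?L (pcompose p Y)" for p
  proof -
    have "(LINT x|\<mu>. poly p x) = (\<Sum>i\<le>degree p. coeff p i * (LINT x|\<mu>. x ^ i))"
      unfolding poly_altdef by (subst Bochner_Integration.integral_sum) (auto intro: pow_int)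
    also have "\<dots> = ?L (\<Sum>i\<le>degree p. smult (coeff p i) (pcompose ([:0, 1:] ^ i) Y))"
      by (simp only: moment_\<mu> moment_functional_sum finite_atMost moment_functional_smult)
    also have "(\<Sum>i\<le>degree p. smult (coeff p i) (pcompose ([:0, 1:] ^ i) Y)) =
        pcompose (\<Sum>i\<le>degree p. monom (coeff p i) i) Y"
      by (simp add: pcompose_sum pcompose_smult[symmetric] monom_altdef)
    finally show ?thesis
      by (simp only: poly_as_sum_of_monoms)
  qed
  define X where "X = [:- R, 2 * R:]"
  define \<nu> where "\<nu> = distr \<mu> borel (poly X)"
  have X_meas [measurable]: "poly X \<in> borel_measurable borel"
    by (intro borel_measurable_continuous_onI continuous_intros)
  show ?thesis
  proof (rule that[of \<nu>])
    show "real_distribution \<nu>"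
      unfolding \<nu>_def real_distribution_def real_distribution_axioms_def
      by (auto intro!: \<mu>.prob_space_distr)
    show "AE x in \<nu>. \<bar>x\<bar> \<le> R"
      unfolding \<nu>_def
    proof (subst AE_distr_iff)
      show "AE x in \<mu>. \<bar>poly X x\<bar> \<le> R"
        using AE_\<mu> by eventually_elim (use R in \<open>auto simp: X_def abs_le_iff algebra_simps intro: mult_left_le\<close>)
    qed auto
    show "(LINT x|\<nu>. x ^ n) = s n" for n
    proof -
      have "(LINT x|\<nu>. x ^ n) = (LINT x|\<mu>. poly (X ^ n) x)"
        unfolding \<nu>_def by (subst integral_distr) (auto intro!: Bochner_Integration.integral_cong)
      also have "\<dots> = ?L (pcompose X Y ^ n)"
        unfolding poly_int by (simp add: pcompose_power)
      also have "pcompose X Y = monom 1 1"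
        using R by (simp add: X_def Y_def pcompose_pCons monom_altdef)
      also have "?L (monom 1 1 ^ n) = s n"
        by (simp add: monom_power moment_functional_monom)
      finally show ?thesis .
    qed
  qed
qed

section \<open>Free convolution with the semicircle law\<close>

definition geometric_fps :: "real \<Rightarrow> real fps" where
  "geometric_fps x = Abs_fps (\<lambda>n. x ^ n)"

lemma geometric_fps_compose:
  assumes "Y $ 0 = 0"
  shows "(geometric_fps x oo Y) * (1 - fps_const x * Y) = 1"
proof -
  have "geometric_fps x * (1 - fps_const x * fps_X) = 1"
  proof (rule fps_ext)
    fix n
    have "(geometric_fps x * (1 - fps_const x * fps_X)) $ n =
        geometric_fps x $ n - (fps_X * (fps_const x * geometric_fps x)) $ n"
      by (simp add: algebra_simps)
    also have "\<dots> = 1 $ n"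
      by (cases n) (simp_all add: geometric_fps_def)
    finally show "(geometric_fps x * (1 - fps_const x * fps_X)) $ n = 1 $ n" .
  qed
  then have "(geometric_fps x * (1 - fps_const x * fps_X)) oo Y = 1"
    by simp
  then show ?thesis
    using assms by (simp add: fps_compose_mult_distrib fps_compose_sub_distrib)
qed

text \<open>
  This is \<open>1 / (1 - w\<^sup>2 M)\<close>. It is written as a composition because coefficients of compositions depend continuously on the
  coefficients of \<open>M\<close>.
\<close>

definition resolvent_shift :: "real fps \<Rightarrow> real fps" where
  "resolvent_shift M = geometric_fps 1 oo (fps_X\<^sup>2 * M)"

lemma resolvent_shift_inverse: "resolvent_shift M * (1 - fps_X\<^sup>2 * M) = 1"
  using geometric_fps_compose[of "fps_X\<^sup>2 * M" 1] by (simp add: resolvent_shift_def)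

text \<open>
  In terms of Cauchy transforms this is \<open>G \<mapsto> G\<^sub>N(z - G(z))\<close>, where \<open>G\<close> is the transform with moment series \<open>M\<close>. The transform
  of the free convolution of \<open>N\<close> with the standard semicircle law is its fixed point.
\<close>

definition subordinate :: "real fps \<Rightarrow> real fps \<Rightarrow> real fps" where
  "subordinate N M = resolvent_shift M * (N oo (fps_X * resolvent_shift M))"

lemma subordinate_nth:
  "subordinate N M $ n =
    (\<Sum>j\<le>n. N $ j * (resolvent_shift M * (fps_X * resolvent_shift M) ^ j) $ n)"
proof -
  define H Y where "H = resolvent_shift M" and "Y = fps_X * H"
  have Y0: "Y $ 0 = 0"
    by (simp add: Y_def)
  have comp: "(N oo Y) $ i = (\<Sum>j\<le>n. N $ j * (Y ^ j) $ i)" if "i \<le> n" for i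
    unfolding fps_compose_nth atLeast0AtMost
    by (rule sum.mono_neutral_left)
       (use that startsby_zero_power_prefix[OF Y0] in auto)
  have "(H * (N oo Y)) $ n = (\<Sum>i\<le>n. \<Sum>j\<le>n. N $ j * (H $ i * (Y ^ j) $ (n - i)))"
    by (simp add: fps_mult_nth atLeast0AtMost comp sum_distrib_left mult_ac)
  also have "\<dots> = (\<Sum>j\<le>n. \<Sum>i\<le>n. N $ j * (H $ i * (Y ^ j) $ (n - i)))"
    by (rule sum.swap)
  also have "\<dots> = (\<Sum>j\<le>n. N $ j * (H * Y ^ j) $ n)"
    by (simp add: fps_mult_nth atLeast0AtMost sum_distrib_left)
  finally show ?thesis
    by (simp add: subordinate_def H_def Y_def)
qed

text \<open>
  For a point mass at \<open>x\<close> the subordinate series is \<open>1 / (1 - x w - w\<^sup>2 M)\<close>, a continued fraction step with tail \<open>M\<close>.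
\<close>

lemma subordinate_geometric_inverse:
  "subordinate (geometric_fps x) M * (1 - fps_const x * fps_X - fps_X\<^sup>2 * M) = 1"
proof -
  define H where "H = resolvent_shift M"
  have "H * (1 - fps_const x * fps_X - fps_X\<^sup>2 * M) = 1 - fps_const x * (fps_X * H)"
    using resolvent_shift_inverse[of M] unfolding H_def[symmetric] by (simp add: algebra_simps)
  then have "subordinate (geometric_fps x) M * (1 - fps_const x * fps_X - fps_X\<^sup>2 * M) =
      (geometric_fps x oo (fps_X * H)) * (1 - fps_const x * (fps_X * H))"
    unfolding subordinate_def H_def[symmetric]
    by (simp only: mult.commute[of H "geometric_fps x oo (fps_X * H)"] mult.assoc)
  also have "\<dots> = 1"
    by (rule geometric_fps_compose) simp
  finally show ?thesis .
qed

lemma (in real_distribution) integrable_power_bounded: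
  assumes "AE x in M. \<bar>x\<bar> \<le> R"
  shows "integrable M (\<lambda>x. x ^ n)"
  by (rule integrable_const_bound[of _ "R ^ n"])
     (use assms in \<open>auto simp: power_abs elim!: eventually_mono intro!: power_mono\<close>)

text \<open>
  The subordinate series is linear in \<open>N\<close>, so it is the mixture over \<open>\<mu>\<close> of the subordinate series of point masses. Each of
  these is positive because continued fraction steps preserve positivity.
\<close>

lemma hankel_psd_subordinate:
  assumes \<mu>: "real_distribution \<mu>" and bounded: "AE x in \<mu>. \<bar>x\<bar> \<le> R"
    and moments: "\<And>n. (LINT x|\<mu>. x ^ n) = N $ n" and M: "hankel_psd (fps_nth M)"
  shows "hankel_psd (fps_nth (subordinate N M))"
  unfolding hankel_psd_def
proof (intro allI)
  fix n c
  interpret \<mu>: real_distribution \<mu> by fact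
  define P where "P x = subordinate (geometric_fps x) M" for x
  have P_nth: "P x $ k = (\<Sum>j\<le>k. x ^ j * (resolvent_shift M * (fps_X * resolvent_shift M) ^ j) $ k)" for x k
    unfolding P_def subordinate_nth by (simp add: geometric_fps_def)
  have int_P: "integrable \<mu> (\<lambda>x. P x $ k)" for k
    unfolding P_nth by (intro Bochner_Integration.integrable_sum integrable_mult_left impI \<mu>.integrable_power_bounded[OF bounded])
  have "(LINT x|\<mu>. P x $ k) = subordinate N M $ k" for k
    unfolding P_nth subordinate_nth
    by (subst Bochner_Integration.integral_sum)
       (auto simp: moments intro!: \<mu>.integrable_power_bounded[OF bounded])
  then have "(\<Sum>i<n. \<Sum>j<n. c i * c j * subordinate N M $ (i + j)) =
      (\<Sum>i<n. \<Sum>j<n. c i * c j * (LINT x|\<mu>. P x $ (i + j)))"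
    by simp
  also have "\<dots> = (LINT x|\<mu>. (\<Sum>i<n. \<Sum>j<n. c i * c j * P x $ (i + j)))"
    by (simp add: Bochner_Integration.integral_sum int_P)
  also have "0 \<le> \<dots>"
  proof (rule Bochner_Integration.integral_nonneg)
    fix x
    have "hankel_psd (fps_nth (P x))"
      unfolding P_def using subordinate_geometric_inverse M by (rule hankel_psd_jacobi)
    then show "0 \<le> (\<Sum>i<n. \<Sum>j<n. c i * c j * P x $ (i + j))"
      by (simp add: hankel_psd_def)
  qed
  finally show "0 \<le> (\<Sum>i<n. \<Sum>j<n. c i * c j * subordinate N M $ (i + j))" .
qed

lemma subordinate_nth_tendsto:
  fixes M :: "'a \<Rightarrow> real fps"
  assumes lim: "\<And>j. j < n \<Longrightarrow> ((\<lambda>t. M t $ j) \<longlongrightarrow> L $ j) F"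
  shows "((\<lambda>t. subordinate N (M t) $ n) \<longlongrightarrow> subordinate N L $ n) F"
proof -
  have square: "((\<lambda>t. (fps_X\<^sup>2 * M t) $ j) \<longlongrightarrow> (fps_X\<^sup>2 * L) $ j) F" if "j \<le> n" for j
    using that by (auto simp: fps_X_power_mult_nth intro!: lim)
  have H: "((\<lambda>t. resolvent_shift (M t) $ j) \<longlongrightarrow> resolvent_shift L $ j) F" if "j \<le> n" for j
    unfolding resolvent_shift_def
    by (intro fps_compose_nth_tendsto tendsto_const square) (use that in simp)
  have XH: "((\<lambda>t. (fps_X * resolvent_shift (M t)) $ j) \<longlongrightarrow> (fps_X * resolvent_shift L) $ j) F" if "j \<le> n" for j
    using that by (auto intro!: H)
  show ?thesis
    unfolding subordinate_def fps_mult_nth[of "resolvent_shift _"]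
    by (intro tendsto_sum tendsto_mult H fps_compose_nth_tendsto tendsto_const XH) auto
qed

text \<open>
  With \<open>y = w L\<close>, the equation \<open>L = C(y) + y\<^sup>2\<close> says \<open>C(y) = L (1 - w\<^sup>2 L)\<close>. So \<open>y / C(y) = w / (1 - w\<^sup>2 L)\<close>, and evaluating
  \<open>N(m / C(m)) = C(m)\<close> at \<open>m = y\<close> gives the fixed point equation.
\<close>

lemma moment_series_add_square_fixpoint:
  assumes C: "C $ 0 \<noteq> 0"
  defines "L \<equiv> moment_series (C + fps_X\<^sup>2)"
  shows "subordinate (moment_series C) L = L"
proof -
  define H y D where "H = resolvent_shift L" and "y = fps_X * L" and "D = C oo y"
  have y0: "y $ 0 = 0"
    by (simp add: y_def)
  have D0: "D $ 0 \<noteq> 0"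
    using C by (simp add: D_def)
  have "L = (C + fps_X\<^sup>2) oo y"
    unfolding y_def L_def by (rule moment_series_fixpoint) (use C in simp)
  also have "\<dots> = D + y\<^sup>2"
    using y0 by (simp add: D_def fps_compose_add_distrib fps_compose_power[symmetric])
  finally have "D = L * (1 - fps_X\<^sup>2 * L)"
    by (simp add: y_def algebra_simps power2_eq_square)
  then have HD: "H * D = L"
    using resolvent_shift_inverse[of L] unfolding H_def[symmetric]
    by (metis mult.left_commute mult.right_neutral)
  have "(fps_X * inverse C) oo y = y * inverse D"
    using y0 C by (simp add: D_def fps_compose_mult_distrib fps_inverse_compose)
  also have "\<dots> = fps_X * H * (inverse D * D)"
    unfolding y_def HD[symmetric] by (simp add: mult_ac)
  also have "\<dots> = fps_X * H"
    using D0 by (simp add: inverse_mult_eq_1)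
  finally have XH: "(fps_X * inverse C) oo y = fps_X * H" .
  have "moment_series C oo (fps_X * H) = (moment_series C oo (fps_X * inverse C)) oo y"
    unfolding XH[symmetric] by (rule fps_compose_assoc) (simp_all add: y0)
  also have "\<dots> = D"
    using moment_series_compose[OF C] by (simp add: D_def)
  finally show ?thesis
    using HD by (simp add: subordinate_def H_def)
qed

lemma (in real_distribution) moment_hankel_psd:
  assumes bounded: "AE x in M. \<bar>x\<bar> \<le> R"
  shows "hankel_psd (\<lambda>n. LINT x|M. x ^ n)"
  unfolding hankel_psd_def
proof (intro allI)
  fix n c
  have "(\<Sum>i<n. \<Sum>j<n. c i * c j * (LINT x|M. x ^ (i + j))) =
      (LINT x|M. (\<Sum>i<n. \<Sum>j<n. c i * c j * x ^ (i + j)))"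
    by (simp add: Bochner_Integration.integral_sum integrable_power_bounded[OF bounded])
  also have "\<dots> = (LINT x|M. (\<Sum>i<n. c i * x ^ i)\<^sup>2)"
    by (simp add: power2_eq_square sum_product power_add mult_ac)
  also have "0 \<le> \<dots>" by simp
  finally show "0 \<le> (\<Sum>i<n. \<Sum>j<n. c i * c j * (LINT x|M. x ^ (i + j)))" .
qed

lemma hankel_psd_imp_measure:
  fixes N :: "real fps"
  assumes N0: "N $ 0 = 1" and rad: "fps_conv_radius N > 0" and psd: "hankel_psd (fps_nth N)"
  obtains \<mu> R where "real_distribution \<mu>" "0 < R" "AE x in \<mu>. \<bar>x\<bar> \<le> R" "\<And>n. (LINT x|\<mu>. x ^ n) = N $ n"
proof -
  obtain r K where r: "0 < r" and "0 < K" and bound: "\<And>n. \<bar>N $ n\<bar> * r ^ n \<le> K"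
    using rad by (rule fps_conv_radius_pos_imp_bound) (rule that)
  obtain \<mu> where "real_distribution \<mu>" "AE x in \<mu>. \<bar>x\<bar> \<le> 1 / r" "\<And>n. (LINT x|\<mu>. x ^ n) = N $ n"
  proof (rule hamburger_moment_problem_bounded[of "fps_nth N" "1 / r" K])
    show "\<bar>N $ n\<bar> \<le> K * (1 / r) ^ n" for n
      using bound[of n] r by (simp add: power_divide field_simps)
  qed (use N0 psd r in auto)
  with r show ?thesis
    by (intro that[of \<mu> "1 / r"]) auto
qed

text \<open>
  Free convolution with the standard semicircle law, as a statement about cumulants. Iterating the subordination map from \<open>0\<close>
  preserves positivity, and each iteration makes one more coefficient agree with the fixed point.
\<close>

theorem hankel_psd_moment_series_add_square:
  assumes rad: "fps_conv_radius C > 0" and C0: "C $ 0 = 1" and psd: "hankel_psd (fps_nth (moment_series C))"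
  shows "hankel_psd (fps_nth (moment_series (C + fps_X\<^sup>2)))"
proof -
  define N L where "N = moment_series C" and "L = moment_series (C + fps_X\<^sup>2)"
  have "fps_conv_radius N > 0" "N $ 0 = 1"
    using fps_conv_radius_moment_series[OF rad] C0 by (simp_all add: N_def)
  from this(2,1) psd obtain \<mu> R where \<mu>: "real_distribution \<mu>" and "0 < R"
    and bounded: "AE x in \<mu>. \<bar>x\<bar> \<le> R" and moments: "\<And>n. (LINT x|\<mu>. x ^ n) = N $ n"
    unfolding N_def[symmetric] by (rule hankel_psd_imp_measure) (rule that)
  define M where "M k = (subordinate N ^^ k) 0" for k
  have M_Suc: "M (Suc k) = subordinate N (M k)" for k
    by (simp add: M_def)
  have M_psd: "hankel_psd (fps_nth (M k))" for k
  proof (induction k)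
    case 0
    show ?case by (simp add: M_def hankel_psd_def)
  next
    case (Suc k)
    then show ?case
      unfolding M_Suc by (rule hankel_psd_subordinate[OF \<mu> bounded moments])
  qed
  have L: "subordinate N L = L"
    unfolding N_def L_def by (rule moment_series_add_square_fixpoint) (simp add: C0)
  have "(\<lambda>k. M k $ n) \<longlonglongrightarrow> L $ n" for n
  proof (induction n rule: less_induct)
    case (less n)
    have "(\<lambda>k. subordinate N (M k) $ n) \<longlonglongrightarrow> subordinate N L $ n"
      by (rule subordinate_nth_tendsto) (rule less.IH)
    then have "(\<lambda>k. M (Suc k) $ n) \<longlonglongrightarrow> L $ n"
      unfolding M_Suc L .
    then show ?case
      by (rule LIMSEQ_imp_Suc)
  qed
  then show ?thesis
    unfolding L_def[symmetric]
    by (rule hankel_psd_limit[OF always_eventually[OF allI[OF M_psd]] sequentially_bot])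
qed

section \<open>Variance functions as free cumulant series\<close>

lemma (in real_distribution) stieltjes_has_fps_expansion:
  assumes R: "0 < R" and bounded: "AE x in M. \<bar>x\<bar> \<le> R"
  shows "(\<lambda>w. LINT x|M. 1 / (1 - w * x)) has_fps_expansion Abs_fps (\<lambda>n. LINT x|M. x ^ n)"
proof (rule has_fps_expansionI)
  have "eventually (\<lambda>w. w \<in> ball 0 (1 / R)) (nhds (0 :: real))"
    by (intro eventually_nhds_in_open) (use R in auto)
  then show "eventually (\<lambda>w. (\<lambda>n. Abs_fps (\<lambda>n. LINT x|M. x ^ n) $ n * w ^ n) sums
      (LINT x|M. 1 / (1 - w * x))) (nhds 0)"
  proof eventually_elim
    case (elim w)
    then have w: "\<bar>w\<bar> * R < 1"
      using R by (simp add: dist_norm field_simps)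
    have small: "AE x in M. \<bar>w * x\<bar> \<le> \<bar>w\<bar> * R"
      using bounded by eventually_elim (simp add: abs_mult mult_left_mono)
    have int: "integrable M (\<lambda>x. (w * x) ^ n)" for n
      unfolding power_mult_distrib
      by (intro integrable_mult_right integrable_power_bounded[OF bounded])
    have "(\<lambda>n. LINT x|M. (w * x) ^ n) sums (LINT x|M. (\<Sum>n. (w * x) ^ n))"
    proof (rule sums_integral[OF int])
      show "AE x in M. summable (\<lambda>n. norm ((w * x) ^ n))"
        using small
      proof eventually_elim
        case (elim x)
        with w have "\<bar>w * x\<bar> < 1" by linarith
        then show ?case
          unfolding norm_power by (intro summable_geometric) simp
      qed
      have "(LINT x|M. norm ((w * x) ^ n)) \<le> (\<bar>w\<bar> * R) ^ n" for n
      proof -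
        have "(LINT x|M. norm ((w * x) ^ n)) \<le> (LINT x|M. (\<bar>w\<bar> * R) ^ n)"
        proof (rule integral_mono_AE)
          show "AE x in M. norm ((w * x) ^ n) \<le> (\<bar>w\<bar> * R) ^ n"
            using small by eventually_elim (simp only: real_norm_def power_abs, intro power_mono, auto)
        qed (use int in auto)
        then show ?thesis
          by (simp add: prob_space[simplified])
      qed
      moreover have "0 \<le> (LINT x|M. norm ((w * x) ^ n))" for n
        by (rule Bochner_Integration.integral_nonneg) (rule norm_ge_zero)
      ultimately have "norm (LINT x|M. norm ((w * x) ^ n)) \<le> (\<bar>w\<bar> * R) ^ n" for n
        by (simp only: real_norm_def abs_of_nonneg)
      moreover have "summable (\<lambda>n. (\<bar>w\<bar> * R) ^ n)"
        by (rule summable_geometric) (use w R in \<open>simp add: abs_mult\<close>)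
      ultimately show "summable (\<lambda>n. LINT x|M. norm ((w * x) ^ n))"
        by (rule summable_comparison_test'[rotated])
    qed
    moreover have "(LINT x|M. (\<Sum>n. (w * x) ^ n)) = (LINT x|M. 1 / (1 - w * x))"
    proof (rule integral_cong_AE)
      show "AE x in M. (\<Sum>n. (w * x) ^ n) = 1 / (1 - w * x)"
        using small
      proof eventually_elim
        case (elim x)
        with w have "\<bar>w * x\<bar> < 1" by linarith
        then show ?case
          by (simp add: suminf_geometric)
      qed
    qed auto
    ultimately show ?case
      by (simp add: power_mult_distrib mult.commute)
  qed
qed

lemma has_fps_expansion_transfer:
  assumes "\<forall>\<^sub>F x in nhds 0. f x = g x" "f has_fps_expansion F"
  shows "g has_fps_expansion F"
  using assms unfolding has_fps_expansion_def by (auto elim: eventually_elim2)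

lemma csk_density_eq:
  assumes "m \<noteq> 0" "V m + m\<^sup>2 \<noteq> 0"
  shows "csk_density V m x = V m / (V m + m\<^sup>2) * (1 / (1 - m / (V m + m\<^sup>2) * x))"
proof -
  have "csk_denom V m x = (V m + m\<^sup>2) * (1 - m / (V m + m\<^sup>2) * x)"
    using assms(2) by (simp add: csk_denom_def field_simps power2_eq_square)
  then show ?thesis
    using assms(1) by (simp add: csk_density_def)
qed

lemma (in real_distribution) csk_density_measurable [measurable]:
  "csk_density V m \<in> borel_measurable M"
  unfolding csk_density_def csk_denom_def by measurable

text \<open>
  The total mass of the density equals \<open>1\<close>, rewritten by pulling \<open>V m + m\<^sup>2\<close> out of the denominator.
\<close>

lemma stieltjes_of_csk_probability:
  assumes "real_distribution \<nu>" "csk_probability \<nu> V m" "V m \<noteq> 0" "V m + m\<^sup>2 \<noteq> 0"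
  shows "(LINT x|\<nu>. 1 / (1 - m / (V m + m\<^sup>2) * x)) = (V m + m\<^sup>2) * inverse (V m)"
proof (cases "m = 0")
  case True
  interpret real_distribution \<nu> by fact
  show ?thesis
    using True assms(3) by (simp add: prob_space[simplified])
next
  case False
  interpret real_distribution \<nu> by fact
  have nonneg: "AE x in \<nu>. 0 \<le> csk_density V m x"
    and prob: "prob_space (density \<nu> (\<lambda>x. ennreal (csk_density V m x)))"
    using assms(2) by (auto simp: csk_probability_def)
  have "(\<integral>\<^sup>+ x. ennreal (csk_density V m x) \<partial>\<nu>) = 1"
    using prob_space.emeasure_space_1[OF prob] by (simp add: emeasure_density cong: nn_integral_cong)
  then have "(LINT x|\<nu>. csk_density V m x) = 1"
    using nonneg by (subst integral_eq_nn_integral) auto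
  then have "V m / (V m + m\<^sup>2) * (LINT x|\<nu>. 1 / (1 - m / (V m + m\<^sup>2) * x)) = 1"
    unfolding csk_density_eq[of m V, OF False assms(4)] by (simp only: integral_mult_right_zero)
  moreover have "I = (V m + m\<^sup>2) * inverse (V m)" if "V m / (V m + m\<^sup>2) * I = 1" for I
    using that assms(3,4) by (simp add: field_simps)
  ultimately show ?thesis by blast
qed

text \<open>
  Let \<open>S\<close> be the moment series of \<open>\<nu>\<close> and \<open>u = m / C(m)\<close> with \<open>C = V + m\<^sup>2\<close>. Total mass \<open>1\<close> gives \<open>S(u) = C / V\<close>. Mean \<open>0\<close> and
  variance \<open>1\<close> give \<open>S = 1 / (1 - w\<^sup>2 N)\<close> with \<open>N(0) = 1\<close>, and stripping this step leaves \<open>N\<close> positive with \<open>N(u) = C\<close>.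
  The constant term of the last equation yields \<open>V(0) = 1\<close>.
\<close>

lemma variance_function_imp_hankel_psd:
  assumes \<nu>: "real_distribution \<nu>" and supp: "compactly_supported \<nu>"
    and mean: "(LINT x|\<nu>. x) = 0" and var: "(LINT x|\<nu>. x\<^sup>2) = 1"
    and V: "is_variance_function \<nu> V"
  obtains F where "V has_fps_expansion F" "F $ 0 = 1"
    "hankel_psd (fps_nth (moment_series (F + fps_X\<^sup>2)))"
proof -
  interpret real_distribution \<nu> by fact
  obtain K where "compact K" and K: "AE x in \<nu>. x \<in> K"
    using supp by (auto simp: compactly_supported_def)
  then obtain R where R: "0 < R" "\<And>x. x \<in> K \<Longrightarrow> \<bar>x\<bar> \<le> R"
    using bounded_pos[of K] compact_imp_bounded by auto
  have bounded: "AE x in \<nu>. \<bar>x\<bar> \<le> R"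
    using K by eventually_elim (rule R(2))
  obtain U a b where U: "0 \<in> U" "V real_analytic_on U" and V0: "V 0 \<noteq> 0"
    and ab: "a < 0" "0 < b" and csk: "\<And>m. m \<in> {a<..<b} \<Longrightarrow> csk_probability \<nu> V m"
    using V by (auto simp: is_variance_function_def)
  obtain F where F: "V has_fps_expansion F"
    using U by (auto simp: real_analytic_on_def)
  define C where "C = F + fps_X\<^sup>2"
  define u where "u = fps_X * inverse C"
  define S where "S = Abs_fps (\<lambda>n. LINT x|\<nu>. x ^ n)"
  have F0: "F $ 0 \<noteq> 0"
    using has_fps_expansion_nth_0[OF F] V0 by simp
  then have C0: "C $ 0 \<noteq> 0"
    by (simp add: C_def)
  have u0: "u $ 0 = 0"
    by (simp add: u_def)
  have C: "(\<lambda>m. V m + m\<^sup>2) has_fps_expansion C"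
    unfolding C_def by (intro fps_expansion_intros F)
  have u: "(\<lambda>m. m * inverse (V m + m\<^sup>2)) has_fps_expansion u"
    unfolding u_def by (intro fps_expansion_intros C C0)
  have lhs: "(\<lambda>m. LINT x|\<nu>. 1 / (1 - m * inverse (V m + m\<^sup>2) * x)) has_fps_expansion (S oo u)"
    unfolding S_def
    by (rule has_fps_expansion_compose_real[OF stieltjes_has_fps_expansion[OF R(1) bounded] u u0])
  have nz: "eventually (\<lambda>m. g m \<noteq> 0) (nhds 0)" if "g has_fps_expansion G" "G $ 0 \<noteq> 0" for g :: "real \<Rightarrow> real" and G
  proof -
    have "isCont g 0"
      using has_fps_expansion_imp_continuous[OF that(1), of UNIV] by simp
    moreover have "g 0 \<noteq> 0"
      using has_fps_expansion_nth_0[OF that(1)] that(2) by simp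
    ultimately show ?thesis
      unfolding isCont_def tendsto_at_iff_tendsto_nhds by (rule tendsto_imp_eventually_ne)
  qed
  have "eventually (\<lambda>m. m \<in> {a<..<b}) (nhds 0)"
    using ab by (intro eventually_nhds_in_open) auto
  then have "eventually (\<lambda>m. (LINT x|\<nu>. 1 / (1 - m * inverse (V m + m\<^sup>2) * x)) =
      (V m + m\<^sup>2) * inverse (V m)) (nhds 0)"
    using nz[OF F F0] nz[OF C C0]
    by eventually_elim (use stieltjes_of_csk_probability[OF \<nu> csk] in \<open>simp add: divide_inverse\<close>)
  then have "(\<lambda>m. (V m + m\<^sup>2) * inverse (V m)) has_fps_expansion (S oo u)"
    using lhs by (rule has_fps_expansion_transfer)
  moreover have "(\<lambda>m. (V m + m\<^sup>2) * inverse (V m)) has_fps_expansion C * inverse F"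
    by (intro fps_expansion_intros C F F0)
  ultimately have Su: "S oo u = C * inverse F"
    by (rule has_fps_expansion_unique)
  have S0: "S $ 0 = 1" and S1: "S $ 1 = 0" and S2: "S $ 2 = 1"
    using mean var by (simp_all add: S_def prob_space[simplified])
  define N where "N = fps_shift 2 (1 - inverse S)"
  have "fps_X\<^sup>2 * N = 1 - inverse S"
  proof (rule fps_ext)
    fix n
    have "inverse S $ 1 = 0"
      using S0 S1 by (simp add: fps_inverse_def)
    then show "(fps_X\<^sup>2 * N) $ n = (1 - inverse S) $ n"
    proof (cases "n < 2")
      case False
      then obtain k where "n = k + 2"
        by (metis add.commute le_Suc_ex not_less)
      then show ?thesis
        by (simp add: fps_X_power_mult_nth N_def)
    qed (use S0 in \<open>auto simp: fps_X_power_mult_nth less_2_cases_iff\<close>)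
  qed
  then have SN: "S * (1 - fps_X\<^sup>2 * N) = 1"
    using S0 by (simp add: inverse_mult_eq_1')
  have "fps_nth S = (\<lambda>n. LINT x|\<nu>. x ^ n)"
    by (simp add: S_def fun_eq_iff)
  then have "hankel_psd (fps_nth S)"
    using moment_hankel_psd[OF bounded] by simp
  then have psd: "hankel_psd (fps_nth N)"
    by (rule hankel_psd_strip[of S 0, rotated]) (use SN in simp)
  have S_eq: "S = 1 + fps_X\<^sup>2 * (N * S)"
    using SN by (simp add: algebra_simps)
  have N0: "N $ 0 = 1"
    using S2 S0 arg_cong[OF S_eq, of "\<lambda>G. G $ 2"] by (simp add: fps_X_power_mult_nth)
  have "(S oo u) * (1 - u\<^sup>2 * (N oo u)) = 1"
  proof -
    have "(S * (1 - fps_X\<^sup>2 * N)) oo u = 1"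
      by (simp add: SN)
    then show ?thesis
      using u0 by (simp add: fps_compose_mult_distrib fps_compose_sub_distrib fps_compose_power[symmetric])
  qed
  then have "F = F * (C * inverse F * (1 - u\<^sup>2 * (N oo u)))"
    by (simp add: Su)
  also have "\<dots> = (F * inverse F) * (C - (C * inverse C) * (fps_X\<^sup>2 * (inverse C * (N oo u))))"
    by (simp add: u_def power2_eq_square algebra_simps)
  also have "\<dots> = C - fps_X\<^sup>2 * (inverse C * (N oo u))"
    by (simp only: inverse_mult_eq_1'[OF F0] inverse_mult_eq_1'[OF C0] mult_1_left)
  finally have "C - fps_X\<^sup>2 * (inverse C * (N oo u)) = F"
    by (rule sym)
  then have "fps_X\<^sup>2 * (inverse C * (N oo u)) = fps_X\<^sup>2 * 1"
    by (simp add: C_def algebra_simps)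
  then have "inverse C * (N oo u) = 1"
    by (metis mult_cancel_left fps_X_neq_zero power_not_zero)
  then have "C * inverse C * (N oo u) = C"
    by (simp add: mult.assoc)
  then have Nu: "N oo u = C"
    using C0 by (simp add: inverse_mult_eq_1')
  then have "moment_series C = N"
    unfolding u_def using C0 by (intro moment_series_eqI')
  moreover have "F $ 0 = 1"
    using arg_cong[OF Nu, of "\<lambda>G. G $ 0"] N0 by (simp add: C_def)
  ultimately show ?thesis
    using that F psd by (simp add: C_def)
qed

text \<open>
  The construction of the preceding lemma run backwards: \<open>S = 1 / (1 - w\<^sup>2 N)\<close> is positive and convergent, so it is
  the moment series of a compactly supported \<open>\<nu>\<close>. Near \<open>m = 0\<close> the kernel is positive on the support because \<open>V(0) = 1\<close>.
\<close>

lemma hankel_psd_imp_variance_function: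
  assumes U: "open U" "0 \<in> U" "V real_analytic_on U"
    and F: "V has_fps_expansion F" and F0: "F $ 0 = 1"
    and psd: "hankel_psd (fps_nth (moment_series (F + fps_X\<^sup>2)))"
  shows "germ V \<in> \<V>"
proof -
  define C where "C = F + fps_X\<^sup>2"
  define u where "u = fps_X * inverse C"
  define N where "N = moment_series C"
  define S where "S = inverse (1 - fps_X\<^sup>2 * N)"
  have C0: "C $ 0 = 1"
    by (simp add: C_def F0)
  have u0: "u $ 0 = 0"
    by (simp add: u_def)
  have C: "(\<lambda>m. V m + m\<^sup>2) has_fps_expansion C"
    unfolding C_def by (intro fps_expansion_intros F)
  have u: "(\<lambda>m. m * inverse (V m + m\<^sup>2)) has_fps_expansion u"
    unfolding u_def by (intro fps_expansion_intros C) (simp add: C0)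
  have N0: "N $ 0 = 1"
    using C0 by (simp add: N_def)
  have Nu: "N oo u = C"
    unfolding N_def u_def using C0 by (intro moment_series_compose) simp
  have SN: "S * (1 - fps_X\<^sup>2 * N) = 1"
    unfolding S_def by (rule inverse_mult_eq_1) simp
  have S_eq: "S = 1 + fps_X\<^sup>2 * (N * S)"
    using SN by (simp add: algebra_simps)
  have S0: "S $ 0 = 1"
    by (simp add: S_def)
  have S1: "S $ 1 = 0" and S2: "S $ 2 = 1"
    using arg_cong[OF S_eq, of "\<lambda>G. G $ 1"] arg_cong[OF S_eq, of "\<lambda>G. G $ 2"] N0 S0
    by (simp_all add: fps_X_power_mult_nth)
  have "fps_conv_radius C > 0"
    using C by (simp add: has_fps_expansion_def)
  then have "fps_conv_radius N > 0"
    unfolding N_def using C0 by (intro fps_conv_radius_moment_series) auto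
  then have "fps_conv_radius (1 - fps_X\<^sup>2 * N) > 0"
    using fps_conv_radius_diff[of 1 "fps_X\<^sup>2 * N"] fps_conv_radius_mult[of "fps_X\<^sup>2" N]
    by (auto intro: less_le_trans)
  then have S_rad: "fps_conv_radius S > 0"
    unfolding S_def by (rule fps_conv_radius_inverse_pos[rotated]) simp
  have "hankel_psd (fps_nth S)"
    by (rule hankel_psd_jacobi[of S 0 N]) (use SN psd in \<open>simp_all add: N_def C_def\<close>)
  from S0 S_rad this obtain \<nu> R where \<nu>: "real_distribution \<nu>" and R: "0 < R" and bounded: "AE x in \<nu>. \<bar>x\<bar> \<le> R"
    and moments: "\<And>n. (LINT x|\<nu>. x ^ n) = S $ n"
    by (rule hankel_psd_imp_measure) (rule that)
  interpret real_distribution \<nu> by fact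
  have "(\<lambda>w. LINT x|\<nu>. 1 / (1 - w * x)) has_fps_expansion S"
    using stieltjes_has_fps_expansion[OF R bounded] by (simp add: moments fps_nth_inverse)
  then have "(\<lambda>m. LINT x|\<nu>. 1 / (1 - m * inverse (V m + m\<^sup>2) * x)) has_fps_expansion (S oo u)"
    using u u0 by (rule has_fps_expansion_compose_real)
  also have "S oo u = C * inverse F"
  proof -
    have "(S * (1 - fps_X\<^sup>2 * N)) oo u = 1"
      by (simp add: SN)
    then have "(S oo u) * (1 - u\<^sup>2 * C) = 1"
      using u0 by (simp add: fps_compose_mult_distrib fps_compose_sub_distrib fps_compose_power[symmetric] Nu)
    moreover have "C * (1 - u\<^sup>2 * C) = C - (C * inverse C) * (C * inverse C) * fps_X\<^sup>2"
      by (simp add: u_def power2_eq_square algebra_simps)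
    then have "C * (1 - u\<^sup>2 * C) = F"
      using C0 by (simp add: inverse_mult_eq_1' C_def)
    ultimately have "(S oo u) * F = C"
      by (metis mult.left_commute mult.right_neutral)
    then have "(S oo u) * (F * inverse F) = C * inverse F"
      by (simp add: mult.assoc[symmetric])
    then show ?thesis
      using F0 by (simp add: inverse_mult_eq_1')
  qed
  finally have "eventually (\<lambda>m. eval_fps (C * inverse F) m =
      (LINT x|\<nu>. 1 / (1 - m * inverse (V m + m\<^sup>2) * x))) (nhds 0)"
    by (simp add: has_fps_expansion_def)
  moreover have "(\<lambda>m. (V m + m\<^sup>2) * inverse (V m)) has_fps_expansion C * inverse F"
    by (intro fps_expansion_intros C F) (simp add: F0)
  then have "eventually (\<lambda>m. eval_fps (C * inverse F) m = (V m + m\<^sup>2) * inverse (V m)) (nhds 0)"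
    by (simp add: has_fps_expansion_def)
  ultimately have stieltjes: "eventually (\<lambda>m. (LINT x|\<nu>. 1 / (1 - m / (V m + m\<^sup>2) * x)) =
      (V m + m\<^sup>2) * inverse (V m)) (nhds 0)"
    by eventually_elim (simp add: divide_inverse)
  have V0: "V 0 = 1"
    using has_fps_expansion_nth_0[OF F] F0 by simp
  have "isCont V 0"
    using has_fps_expansion_imp_continuous[OF F, of UNIV] by simp
  then have "isCont (\<lambda>m. V m - \<bar>m\<bar> * R) 0"
    by (intro continuous_intros)
  then have "((\<lambda>m. V m - \<bar>m\<bar> * R) \<longlongrightarrow> V 0 - \<bar>0\<bar> * R) (nhds 0)"
    using tendsto_at_iff_tendsto_nhds[of "\<lambda>m. V m - \<bar>m\<bar> * R" 0] by (simp add: isCont_def)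
  then have "eventually (\<lambda>m. V m - \<bar>m\<bar> * R > 0) (nhds 0)"
    using V0 by (intro order_tendstoD) auto
  with stieltjes have "eventually (\<lambda>m. csk_probability \<nu> V m) (nhds 0)"
  proof eventually_elim
    case (elim m)
    have V_pos: "0 < V m"
      using elim(2) R by (smt (verit) mult_nonneg_nonneg)
    then have C_pos: "0 < V m + m\<^sup>2"
      by (simp add: add_pos_nonneg)
    have denom: "AE x in \<nu>. 0 < csk_denom V m x"
      using bounded
    proof eventually_elim
      case (elim x)
      have "m * x \<le> \<bar>m\<bar> * \<bar>x\<bar>"
        using abs_ge_self[of "m * x"] by (simp only: abs_mult)
      also have "\<dots> \<le> \<bar>m\<bar> * R"
        using elim by (rule mult_left_mono) simp
      finally have "m * x < V m + m * m"
        using \<open>V m - \<bar>m\<bar> * R > 0\<close> zero_le_square[of m] by linarith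
      then show ?case
        by (simp add: csk_denom_def right_diff_distrib)
    qed
    have nonneg: "AE x in \<nu>. 0 \<le> csk_density V m x"
      using denom by eventually_elim (use V_pos in \<open>auto simp: csk_density_def\<close>)
    have "(LINT x|\<nu>. csk_density V m x) = 1"
    proof (cases "m = 0")
      case True
      then show ?thesis by (simp add: csk_density_def prob_space[simplified])
    next
      case False
      have "(LINT x|\<nu>. csk_density V m x) = V m / (V m + m\<^sup>2) * ((V m + m\<^sup>2) * inverse (V m))"
        unfolding csk_density_eq[of m V, OF False less_imp_neq[OF C_pos, symmetric]] integral_mult_right_zero elim(1) ..
      then show ?thesis
        using C_pos V_pos by simp
    qed
    \<comment> \<open>a nonintegrable function would have integral \<open>0\<close>\<close>
    moreover have "integrable \<nu> (csk_density V m)"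
      using calculation not_integrable_integral_eq[of \<nu> "csk_density V m"] by fastforce
    ultimately have "(\<integral>\<^sup>+ x. ennreal (csk_density V m x) \<partial>\<nu>) = 1"
      using nonneg by (subst nn_integral_eq_integral) auto
    then have "prob_space (density \<nu> (\<lambda>x. ennreal (csk_density V m x)))"
      by (intro prob_spaceI) (simp add: emeasure_density cong: nn_integral_cong)
    moreover have "AE x in \<nu>. csk_denom V m x \<noteq> 0"
      using denom by eventually_elim simp
    ultimately show ?case
      using nonneg by (simp add: csk_probability_def)
  qed
  then obtain e where e: "0 < e" "\<And>m. dist m 0 < e \<Longrightarrow> csk_probability \<nu> V m"
    by (auto simp: eventually_nhds_metric)
  have "is_variance_function \<nu> V"
    unfolding is_variance_function_def
  proof (intro conjI)
    show "\<exists>a b. a < 0 \<and> 0 < b \<and> (\<forall>m\<in>{a<..<b}. csk_probability \<nu> V m)"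
      using e by (intro exI[of _ "-e"] exI[of _ e]) (auto simp: dist_norm)
  qed (use U V0 in auto)
  moreover have "compactly_supported \<nu>"
    unfolding compactly_supported_def
    by (rule exI[of _ "cball 0 R"]) (use bounded in \<open>simp add: dist_norm\<close>)
  moreover have "(LINT x|\<nu>. x) = 0" "(LINT x|\<nu>. x\<^sup>2) = 1"
    using moments[of 1] moments[of 2] S1 S2 by simp_all
  ultimately show ?thesis
    using \<nu> by (auto simp: variance_germs_def)
qed

lemma variance_germE:
  assumes "v \<in> \<V>"
  obtains V U F where "v = germ V" "open U" "0 \<in> U" "V real_analytic_on U"
    "V has_fps_expansion F" "F $ 0 = 1" "hankel_psd (fps_nth (moment_series (F + fps_X\<^sup>2)))"
proof -
  obtain V \<nu> where *: "v = germ V" "real_distribution \<nu>" "compactly_supported \<nu>"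
    "(LINT x|\<nu>. x) = 0" "(LINT x|\<nu>. x\<^sup>2) = 1" "is_variance_function \<nu> V"
    using assms by (auto simp: variance_germs_def)
  obtain F where "V has_fps_expansion F" "F $ 0 = 1" "hankel_psd (fps_nth (moment_series (F + fps_X\<^sup>2)))"
    using variance_function_imp_hankel_psd[OF *(2-6)] by blast
  with * show ?thesis
    by (auto simp: is_variance_function_def intro!: that)
qed

lemma has_fps_expansion_dilate:
  fixes f :: "real \<Rightarrow> real"
  assumes "f has_fps_expansion F"
  shows "(\<lambda>x. f (c * x)) has_fps_expansion (F oo (fps_const c * fps_X))"
  by (rule has_fps_expansion_compose_real[OF assms])
     (auto intro!: has_fps_expansion_cmult_left has_fps_expansion_fps_X)

lemma real_analytic_on_dilate:
  assumes "V real_analytic_on U"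
  shows "(\<lambda>m. V (c * m)) real_analytic_on {m. c * m \<in> U}"
  unfolding real_analytic_on_def
proof
  fix x assume "x \<in> {m. c * m \<in> U}"
  then obtain F where "(\<lambda>h. V (c * x + h)) has_fps_expansion F"
    using assms by (auto simp: real_analytic_on_def)
  from has_fps_expansion_dilate[OF this, of c]
  show "\<exists>F. (\<lambda>h. V (c * (x + h))) has_fps_expansion F"
    by (auto simp: distrib_left)
qed

lemma real_analytic_on_add_square:
  assumes "V real_analytic_on U"
  shows "(\<lambda>m. V m + a * m\<^sup>2) real_analytic_on U"
  unfolding real_analytic_on_def
proof
  fix x assume "x \<in> U"
  then obtain F where F: "(\<lambda>h. V (x + h)) has_fps_expansion F"
    using assms by (auto simp: real_analytic_on_def)
  have "(\<lambda>h. V (x + h) + a * ((x + h) * (x + h))) has_fps_expansion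
      F + fps_const a * ((fps_const x + fps_X) * (fps_const x + fps_X))"
    by (intro fps_expansion_intros F)
  then show "\<exists>F. (\<lambda>h. V (x + h) + a * (x + h)\<^sup>2) has_fps_expansion F"
    by (auto simp: power2_eq_square)
qed

lemma germ_eq_iff: "germ f = germ g \<longleftrightarrow> (\<forall>\<^sub>F m in nhds 0. f m = g m)"
  by (rule real_germ.abs_eq_iff)

lemma fps_compose_linear_nth:
  fixes M :: "real fps"
  shows "fps_nth (M oo (fps_const c * fps_X)) = (\<lambda>n. c ^ n * M $ n)"
  by (simp add: fun_eq_iff fps_compose_linear)

lemma hankel_psd_dilate:
  assumes "hankel_psd (fps_nth M)"
  shows "hankel_psd (fps_nth (M oo (fps_const c * fps_X)))"
  using hankel_psd_scale[OF assms, of c] by (simp add: fps_compose_linear_nth)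

text \<open>
  Undoing the dilation by \<open>c\<close> turns membership of \<open>V(c m)\<close> into positivity for the cumulant series \<open>V + m\<^sup>2 / c\<^sup>2\<close>. As \<open>c\<close> grows,
  positivity passes to \<open>V = (V - m\<^sup>2) + m\<^sup>2\<close>.
\<close>

lemma germ_minus_square_in_variance_germs:
  assumes "v \<in> \<V>\<^sub>\<infinity>"
  shows "germ_minus_square v \<in> \<V>"
proof -
  have "v \<in> \<V>" and dil: "\<And>c. germ_dilate c v \<in> \<V>"
    using assms by (auto simp: variance_germs_inf_def)
  then obtain V U F where v: "v = germ V" and U: "open U" "0 \<in> U" "V real_analytic_on U"
    and F: "V has_fps_expansion F" and F0: "F $ 0 = 1"
    by (auto elim: variance_germE)
  have psd: "hankel_psd (fps_nth (moment_series (F + fps_const (1 / c\<^sup>2) * fps_X\<^sup>2)))" if c: "0 < c" for c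
  proof -
    define D where "D = fps_const c * fps_X"
    have "germ (\<lambda>m. V (c * m)) \<in> \<V>"
      using dil[of c] by (simp add: v germ_dilate.abs_eq)
    then obtain W G where W: "germ (\<lambda>m. V (c * m)) = germ W" and G: "W has_fps_expansion G"
      and psd_G: "hankel_psd (fps_nth (moment_series (G + fps_X\<^sup>2)))"
      by (auto elim: variance_germE)
    have "(\<lambda>m. V (c * m)) has_fps_expansion G"
      using has_fps_expansion_transfer[of W "\<lambda>m. V (c * m)" G] W G
      unfolding germ_eq_iff by (simp add: eq_commute)
    then have "G = F oo D"
      unfolding D_def using has_fps_expansion_dilate[OF F] by (rule has_fps_expansion_unique)
    moreover have "(fps_const (1 / c\<^sup>2) * fps_X\<^sup>2) oo D = fps_X\<^sup>2"
      using c by (simp add: D_def fps_compose_mult_distrib fps_compose_power[symmetric] power_mult_distrib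
          fps_const_power mult.assoc[symmetric] fps_const_mult)
    ultimately have "G + fps_X\<^sup>2 = (F + fps_const (1 / c\<^sup>2) * fps_X\<^sup>2) oo D"
      by (simp add: fps_compose_add_distrib)
    then have "moment_series (G + fps_X\<^sup>2) = moment_series (F + fps_const (1 / c\<^sup>2) * fps_X\<^sup>2) oo D"
      unfolding D_def by (simp add: moment_series_dilate F0)
    then have "hankel_psd (\<lambda>n. c ^ n * moment_series (F + fps_const (1 / c\<^sup>2) * fps_X\<^sup>2) $ n)"
      using psd_G by (simp add: D_def fps_compose_linear_nth)
    from hankel_psd_scale[OF this, of "1 / c"] show ?thesis
      using c by (simp add: power_divide)
  qed
  have "hankel_psd (fps_nth (moment_series F))"
  proof (rule hankel_psd_limit)
    define t where "t k = 1 / (real (Suc k))\<^sup>2" for k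
    have "(\<lambda>k. (1 / real (Suc k)) ^ 2) \<longlonglongrightarrow> 0 ^ 2"
      using LIMSEQ_inverse_real_of_nat by (intro tendsto_power) (simp add: inverse_eq_divide)
    then have t: "t \<longlonglongrightarrow> 0"
      by (simp add: t_def[abs_def] power_divide)
    show "\<forall>\<^sub>F k in sequentially. hankel_psd (fps_nth (moment_series (F + fps_const (t k) * fps_X\<^sup>2)))"
      unfolding t_def by (intro always_eventually allI psd) simp
    show "(\<lambda>k. moment_series (F + fps_const (t k) * fps_X\<^sup>2) $ n) \<longlonglongrightarrow> moment_series F $ n" for n
    proof (rule moment_fixpoint_tendsto)
      show "(\<lambda>k. (F + fps_const (t k) * fps_X\<^sup>2) $ n) \<longlonglongrightarrow> F $ n" for n
        using tendsto_add[OF tendsto_const[of "F $ n"] tendsto_mult[OF t tendsto_const[of "(fps_X\<^sup>2) $ n"]]]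
        by simp
      show "\<forall>\<^sub>F k in sequentially. moment_series (F + fps_const (t k) * fps_X\<^sup>2) =
          (F + fps_const (t k) * fps_X\<^sup>2) oo (fps_X * moment_series (F + fps_const (t k) * fps_X\<^sup>2))"
        by (intro always_eventually allI moment_series_fixpoint) (simp add: F0)
    qed (intro moment_series_fixpoint, simp add: F0)
  qed simp
  then have "germ (\<lambda>m. V m - m\<^sup>2) \<in> \<V>"
    using real_analytic_on_add_square[OF U(3), of "-1"] F0
    by (intro hankel_psd_imp_variance_function[OF U(1,2), of _ "F - fps_X\<^sup>2"])
       (auto intro!: fps_expansion_intros F)
  then show ?thesis
    by (simp add: v germ_minus_square.abs_eq)
qed

text \<open>
  If \<open>V = W + m\<^sup>2\<close> is a free cumulant series of a measure, then so are all its dilates \<open>V(c m)\<close>, and adding a semicircle shows that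
  \<open>V(c m) + m\<^sup>2\<close> is one as well, so that \<open>V(c m)\<close> is a variance function.
\<close>

lemma variance_germ_add_square:
  assumes "w \<in> \<V>"
  obtains v where "v \<in> \<V>\<^sub>\<infinity>" "germ_minus_square v = w"
proof -
  obtain W U G where w: "w = germ W" and U: "open U" "0 \<in> U" "W real_analytic_on U"
    and G: "W has_fps_expansion G" and G0: "G $ 0 = 1"
    and psd: "hankel_psd (fps_nth (moment_series (G + fps_X\<^sup>2)))"
    using assms by (rule variance_germE)
  define V F where "V m = W m + m\<^sup>2" and "F = G + fps_X\<^sup>2" for m
  have V: "V real_analytic_on U"
    using real_analytic_on_add_square[OF U(3), of 1] by (simp add: V_def[abs_def])
  have F: "V has_fps_expansion F"
    unfolding V_def F_def by (intro fps_expansion_intros G)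
  have F0: "F $ 0 = 1"
    by (simp add: F_def G0)
  have dil: "germ (\<lambda>m. V (c * m)) \<in> \<V>" for c
  proof (rule hankel_psd_imp_variance_function)
    let ?D = "fps_const c * fps_X :: real fps"
    show "open {m. c * m \<in> U}"
      using U(1) continuous_open_vimage[of U "\<lambda>m. c * m"] by (auto simp: vimage_def)
    show "(\<lambda>m. V (c * m)) real_analytic_on {m. c * m \<in> U}"
      using V by (rule real_analytic_on_dilate)
    show FD: "(\<lambda>m. V (c * m)) has_fps_expansion (F oo ?D)"
      using F by (rule has_fps_expansion_dilate)
    show "hankel_psd (fps_nth (moment_series ((F oo ?D) + fps_X\<^sup>2)))"
    proof (rule hankel_psd_moment_series_add_square)
      show "fps_conv_radius (F oo ?D) > 0"
        using FD by (simp add: has_fps_expansion_def)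
      show "hankel_psd (fps_nth (moment_series (F oo ?D)))"
        using psd F0 by (simp add: moment_series_dilate hankel_psd_dilate F_def[symmetric])
    qed (simp add: F0)
  qed (use U(2) F0 in auto)
  have "germ V \<in> \<V>\<^sub>\<infinity>"
    using dil dil[of 1] by (auto simp: variance_germs_inf_def germ_dilate.abs_eq)
  moreover have "germ_minus_square (germ V) = w"
    by (simp add: w germ_minus_square.abs_eq V_def)
  ultimately show ?thesis
    by (rule that)
qed

lemma inj_germ_minus_square: "inj germ_minus_square"
proof (rule injI)
  fix v w assume "germ_minus_square v = germ_minus_square w"
  then show "v = w"
    by (induction v rule: real_germ.abs_induct, induction w rule: real_germ.abs_induct)
       (simp add: germ_minus_square.abs_eq germ_eq_iff)
qed

theorem corollary1p1:
  shows "bij_betw germ_minus_square \<V>\<^sub>\<infinity> \<V>"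
  unfolding bij_betw_def
proof
  show "inj_on germ_minus_square \<V>\<^sub>\<infinity>"
    using inj_germ_minus_square by (rule inj_on_subset) simp
  show "germ_minus_square ` \<V>\<^sub>\<infinity> = \<V>"
    by (auto intro: germ_minus_square_in_variance_germs elim!: variance_germ_add_square)
qed

end
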